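(* For every $n\ge1$, the Margolis-Rhodes monoid $\operatorname{MR}(C_n)$ of the cycle graph $C_n$ has Krohn-Rhodes complexity satisfying $$\operatorname{MR}(C_n)c=2\iff n\ge 4.$$
   Context: For $n\ge3$, $C_n$ is the cycle graph on $n$ vertices; by convention $C_1=P_1$ (one vertex) and $C_2=P_2$ (a single edge). For a finite simple graph $\Gamma=(V,E)$, the simplices are the singletons $\{v\}$, $v\in V$, and the edges. $\operatorname{MR}(\Gamma)$ is the monoid of all partial functions $f:V\to V$ (acting on the right, composed left to right) such that for every simplex $\sigma$ the full preimage $\sigma f^{-1}$ is a simplex or empty. Krohn-Rhodes complexity: a finite semigroup $S$ divides $T$ ($S\prec T$) if $S$ is a homomorphic image of a subsemigroup of $T$. The wreath product of transformation semigroups $(X,S)\wr(Y,T)$ acts on $X\times Y$ with semigroup $S^Y\times T$ via $(x,y)(f,t)=(x(yf),yt)$; for abstract semigroups one uses the right action of $S$ on $S$ with an identity adjoined if necessary. A finite semigroup is aperiodic if all its subgroups are trivial. The complexity $Sc$ of a finite semigroup $S$ is the least $n\ge0$ such that $S\prec A_n\wr G_n\wr A_{n-1}\wr\cdots\wr G_1\wr A_0$ with each $G_i$ a finite group and each $A_i$ a finite aperiodic semigroup. *)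

theory Defs
  imports "HOL-Algebra.Group"
begin

record 'a sgp = "'a partial_object" +
  sgmult :: "'a \<Rightarrow> 'a \<Rightarrow> 'a" (infixl \<open>\<odot>\<index>\<close> 70)

definition finite_sgp :: "('a, 'b) sgp_scheme \<Rightarrow> bool" where
  "finite_sgp S \<longleftrightarrow>
     finite (carrier S) \<and> carrier S \<noteq> {} \<and>
     (\<forall>x\<in>carrier S. \<forall>y\<in>carrier S. x \<odot>\<^bsub>S\<^esub> y \<in> carrier S) \<and>
     (\<forall>x\<in>carrier S. \<forall>y\<in>carrier S. \<forall>z\<in>carrier S.
        x \<odot>\<^bsub>S\<^esub> y \<odot>\<^bsub>S\<^esub> z = x \<odot>\<^bsub>S\<^esub> (y \<odot>\<^bsub>S\<^esub> z))"

definition is_group :: "'a sgp \<Rightarrow> bool" where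
  "is_group S \<longleftrightarrow> (\<exists>e. group \<lparr>carrier = carrier S, mult = sgmult S, one = e\<rparr>)"

text \<open>A subgroup of a semigroup is a subset that is a group under the induced
  multiplication; its identity is an arbitrary idempotent.\<close>

definition aperiodic :: "'a sgp \<Rightarrow> bool" where
  "aperiodic S \<longleftrightarrow>
     (\<forall>H \<subseteq> carrier S. is_group (S\<lparr>carrier := H\<rparr>) \<longrightarrow> card H = 1)"

definition sgp_hom :: "'a sgp \<Rightarrow> 'b sgp \<Rightarrow> ('a \<Rightarrow> 'b) set" where
  "sgp_hom S T =
     {h. h \<in> carrier S \<rightarrow> carrier T \<and>
         (\<forall>x\<in>carrier S. \<forall>y\<in>carrier S. h (x \<odot>\<^bsub>S\<^esub> y) = h x \<odot>\<^bsub>T\<^esub> h y)}"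

definition subsgp :: "'a set \<Rightarrow> 'a sgp \<Rightarrow> bool" where
  "subsgp U T \<longleftrightarrow>
     U \<noteq> {} \<and> U \<subseteq> carrier T \<and> (\<forall>x\<in>U. \<forall>y\<in>U. x \<odot>\<^bsub>T\<^esub> y \<in> U)"

definition divides :: "'a sgp \<Rightarrow> 'b sgp \<Rightarrow> bool" (infix \<open>\<prec>\<prec>\<close> 50) where
  "S \<prec>\<prec> T \<longleftrightarrow>
     (\<exists>U h. subsgp U T \<and> h \<in> sgp_hom (T\<lparr>carrier := U\<rparr>) S \<and> h ` U = carrier S)"

record ('x, 's) tsgp =
  states :: "'x set"
  sgp_of :: "'s sgp"
  act :: "'x \<Rightarrow> 's \<Rightarrow> 'x"

definition has_identity :: "'a sgp \<Rightarrow> bool" where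
  "has_identity S \<longleftrightarrow>
     (\<exists>e\<in>carrier S. \<forall>x\<in>carrier S. e \<odot>\<^bsub>S\<^esub> x = x \<and> x \<odot>\<^bsub>S\<^esub> e = x)"

text \<open>The right action of \<open>S\<close> on \<open>S\<close> with an identity (here \<^term>\<open>None\<close>) adjoined
  only when \<open>S\<close> has none.\<close>

definition regular :: "'s sgp \<Rightarrow> ('s option, 's) tsgp" where
  "regular S =
     \<lparr>states = (if has_identity S then Some ` carrier S
                else insert None (Some ` carrier S)),
      sgp_of = S,
      act = (\<lambda>x s. case x of None \<Rightarrow> Some s | Some a \<Rightarrow> Some (a \<odot>\<^bsub>S\<^esub> s))\<rparr>"

text \<open>Elements are pairs \<open>(f, t)\<close> in \<open>S\<^sup>Y \<times> T\<close>. The multiplication is the one for which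
  \<open>(x, y) (f, t) = (x (y f), y t)\<close> is a right action.\<close>

definition wreath ::
  "('x, 's) tsgp \<Rightarrow> ('y, 't) tsgp \<Rightarrow> ('x \<times> 'y, ('y \<Rightarrow> 's) \<times> 't) tsgp"
  where
  "wreath P Q =
     \<lparr>states = states P \<times> states Q,
      sgp_of =
        \<lparr>carrier = (states Q \<rightarrow>\<^sub>E carrier (sgp_of P)) \<times> carrier (sgp_of Q),
         sgmult = (\<lambda>(f, t) (g, u).
           (\<lambda>y\<in>states Q. f y \<odot>\<^bsub>sgp_of P\<^esub> g (act Q y t), t \<odot>\<^bsub>sgp_of Q\<^esub> u))\<rparr>,
      act = (\<lambda>(x, y) (f, t). (act P x (f y), act Q y t))\<rparr>"

definition tsgp_iso :: "('x, 's) tsgp \<Rightarrow> ('y, 't) tsgp \<Rightarrow> bool" where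
  "tsgp_iso P Q \<longleftrightarrow>
     (\<exists>\<phi> \<psi>. bij_betw \<phi> (states P) (states Q) \<and>
        bij_betw \<psi> (carrier (sgp_of P)) (carrier (sgp_of Q)) \<and>
        \<psi> \<in> sgp_hom (sgp_of P) (sgp_of Q) \<and>
        (\<forall>x\<in>states P. \<forall>s\<in>carrier (sgp_of P). \<phi> (act P x s) = act Q (\<phi> x) (\<psi> s)))"

text \<open>\<open>iter_wreath [S\<^sub>k, \<dots>, S\<^sub>0] W\<close> says that \<open>W\<close> is an isomorphic copy of
  \<open>S\<^sub>k \<wr> \<dots> \<wr> S\<^sub>0\<close>. The type of a wreath product grows with the number of factors, so
  each stage is replaced by a copy living on \<^typ>\<open>nat\<close>; as everything is finite, such
  copies always exist. The wreath product of transformation semigroups is associative up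
  to isomorphism, so the bracketing (to the right) is immaterial.\<close>

inductive iter_wreath :: "nat sgp list \<Rightarrow> (nat, nat) tsgp \<Rightarrow> bool" where
  single: "tsgp_iso (regular S) W \<Longrightarrow> iter_wreath [S] W"
| cons: "iter_wreath Ss V \<Longrightarrow> tsgp_iso (wreath (regular S) V) W \<Longrightarrow>
         iter_wreath (S # Ss) W"

text \<open>The factors \<open>A\<^sub>n, G\<^sub>n, A\<^sub>n\<^sub>-\<^sub>1, \<dots>, G\<^sub>1, A\<^sub>0\<close>.\<close>

fun kr_factors :: "(nat \<Rightarrow> 'a) \<Rightarrow> (nat \<Rightarrow> 'a) \<Rightarrow> nat \<Rightarrow> 'a list" where
  "kr_factors A G 0 = [A 0]"
| "kr_factors A G (Suc n) = A (Suc n) # G (Suc n) # kr_factors A G n"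

text \<open>Every finite semigroup has an isomorphic copy with carrier in \<^typ>\<open>nat\<close>, so letting
  the factors range over \<^typ>\<open>nat sgp\<close> is no restriction.\<close>

definition kr_decomposable :: "'a sgp \<Rightarrow> nat \<Rightarrow> bool" where
  "kr_decomposable S n \<longleftrightarrow>
     (\<exists>(A :: nat \<Rightarrow> nat sgp) (G :: nat \<Rightarrow> nat sgp) W.
        (\<forall>i\<le>n. finite_sgp (A i) \<and> aperiodic (A i)) \<and>
        (\<forall>i\<in>{1..n}. finite_sgp (G i) \<and> is_group (G i)) \<and>
        iter_wreath (kr_factors A G n) W \<and> S \<prec>\<prec> sgp_of W)"

text \<open>By the Krohn-Rhodes theorem the least \<open>n\<close> exists for every finite semigroup.\<close>

definition kr_complexity :: "'a sgp \<Rightarrow> nat" where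
  "kr_complexity S = (LEAST n. kr_decomposable S n)"

text \<open>A graph is a pair of a vertex set and a set of two-element sets of vertices.\<close>

type_synonym 'v graph = "'v set \<times> 'v set set"

definition finite_simple_graph :: "'v graph \<Rightarrow> bool" where
  "finite_simple_graph \<Gamma> \<longleftrightarrow>
     finite (fst \<Gamma>) \<and> (\<forall>e\<in>snd \<Gamma>. e \<subseteq> fst \<Gamma> \<and> card e = 2)"

definition simplices :: "'v graph \<Rightarrow> 'v set set" where
  "simplices \<Gamma> = (\<lambda>v. {v}) ` fst \<Gamma> \<union> snd \<Gamma>"

definition full_preimage :: "('v \<rightharpoonup> 'v) \<Rightarrow> 'v set \<Rightarrow> 'v set" where
  "full_preimage f \<sigma> = {v. \<exists>w\<in>\<sigma>. f v = Some w}"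

text \<open>Partial functions act on the right, so the product of \<open>f\<close> and \<open>g\<close> is
  ``first \<open>f\<close>, then \<open>g\<close>''.\<close>

definition MR :: "'v graph \<Rightarrow> ('v \<rightharpoonup> 'v) sgp" where
  "MR \<Gamma> =
     \<lparr>carrier = {f. dom f \<subseteq> fst \<Gamma> \<and> ran f \<subseteq> fst \<Gamma> \<and>
        (\<forall>\<sigma>\<in>simplices \<Gamma>. full_preimage f \<sigma> \<in> simplices \<Gamma> \<or> full_preimage f \<sigma> = {})},
      sgmult = (\<lambda>f g. g \<circ>\<^sub>m f)\<rparr>"

text \<open>For \<open>n \<ge> 3\<close> this is the \<open>n\<close>-cycle. For \<open>n = 2\<close> the two edges coincide, and for
  \<open>n = 1\<close> the would-be loop is discarded, giving \<open>C\<^sub>2 = P\<^sub>2\<close> and \<open>C\<^sub>1 = P\<^sub>1\<close>.\<close>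

definition cycle_graph :: "nat \<Rightarrow> nat graph" where
  "cycle_graph n =
     ({..<n}, {{i, Suc i mod n} | i. i < n \<and> Suc i mod n \<noteq> i})"

lemma cycle_graph_1: "cycle_graph 1 = ({0}, {})"
  by (auto simp: cycle_graph_def)

lemma cycle_graph_2: "cycle_graph 2 = ({0, 1}, {{0, 1}})"
proof -
  have V: "{..<2} = {0, 1 :: nat}" by auto
  have E: "{i :: nat. i < 2 \<and> Suc i mod 2 \<noteq> i} = {0, 1}" by auto
  have "snd (cycle_graph 2) = (\<lambda>i. {i, Suc i mod 2}) ` {i. i < 2 \<and> Suc i mod 2 \<noteq> i}"
    unfolding cycle_graph_def snd_conv by (rule setcompr_eq_image)
  also have "\<dots> = {{0, 1}}"
    unfolding E by (simp add: insert_commute)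
  finally show ?thesis
    by (simp add: prod_eq_iff V cycle_graph_def)
qed

lemma finite_simple_graph_cycle_graph: "finite_simple_graph (cycle_graph n)"
proof -
  have "{i, Suc i mod n} \<subseteq> {..<n}" "card {i, Suc i mod n} = 2"
    if "i < n" "Suc i mod n \<noteq> i" for i
    using that by auto
  then show ?thesis
    unfolding finite_simple_graph_def cycle_graph_def by auto
qed

lemma finite_sgp_MR:
  assumes "finite_simple_graph \<Gamma>"
  shows "finite_sgp (MR \<Gamma>)"
proof -
  let ?V = "fst \<Gamma>"
  have fin: "finite ?V" using assms by (simp add: finite_simple_graph_def)
  have "carrier (MR \<Gamma>) \<subseteq> (\<Union>D\<in>Pow ?V. {f. dom f = D \<and> ran f \<subseteq> ?V})"
    by (auto simp: MR_def)
  moreover have "finite (\<Union>D\<in>Pow ?V. {f. dom f = D \<and> ran f \<subseteq> ?V})"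
  proof (rule finite_UN_I)
    show "finite (Pow ?V)" using fin by simp
    show "finite {f. dom f = D \<and> ran f \<subseteq> ?V}" if "D \<in> Pow ?V" for D
      using that fin finite_subset[of D ?V] by (intro finite_set_of_finite_maps) auto
  qed
  ultimately have 1: "finite (carrier (MR \<Gamma>))" by (rule finite_subset)
  have "Map.empty \<in> carrier (MR \<Gamma>)"
    by (auto simp: MR_def full_preimage_def)
  moreover have "f \<odot>\<^bsub>MR \<Gamma>\<^esub> g \<in> carrier (MR \<Gamma>)"
    if f: "f \<in> carrier (MR \<Gamma>)" and g: "g \<in> carrier (MR \<Gamma>)" for f g
  proof -
    have pre: "full_preimage (g \<circ>\<^sub>m f) \<sigma> = full_preimage f (full_preimage g \<sigma>)" for \<sigma>
      by (auto simp: full_preimage_def map_comp_Some_iff)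
    have emp: "full_preimage f {} = {}" by (simp add: full_preimage_def)
    have "dom (g \<circ>\<^sub>m f) \<subseteq> ?V" "ran (g \<circ>\<^sub>m f) \<subseteq> ?V"
      using f g by (auto simp: MR_def map_comp_Some_iff ran_def dom_def subset_iff)
    moreover have "full_preimage (g \<circ>\<^sub>m f) \<sigma> \<in> simplices \<Gamma> \<or> full_preimage (g \<circ>\<^sub>m f) \<sigma> = {}"
      if "\<sigma> \<in> simplices \<Gamma>" for \<sigma>
    proof -
      have "full_preimage g \<sigma> \<in> simplices \<Gamma> \<or> full_preimage g \<sigma> = {}"
        using g that by (simp add: MR_def)
      then show ?thesis
      proof
        assume "full_preimage g \<sigma> \<in> simplices \<Gamma>"
        then show ?thesis using f by (simp add: MR_def pre)
      qed (simp add: pre emp)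
    qed
    ultimately show ?thesis by (simp add: MR_def)
  qed
  moreover have "f \<odot>\<^bsub>MR \<Gamma>\<^esub> g \<odot>\<^bsub>MR \<Gamma>\<^esub> h = f \<odot>\<^bsub>MR \<Gamma>\<^esub> (g \<odot>\<^bsub>MR \<Gamma>\<^esub> h)" for f g h
    by (auto simp: MR_def map_comp_def fun_eq_iff split: option.split)
  ultimately show ?thesis using 1 unfolding finite_sgp_def by blast
qed

end

theory Submission
  imports Defs "HOL-Combinatorics.Permutations"
begin

text \<open>
  The monoid of a cycle has complexity at most 2 because the monoid of every finite simple
  graph \<open>\<Gamma>\<close> does (\<open>kr_decomposable_MR\<close>), and complexity at most 1 if \<open>n \<le> 3\<close> because the
  graph is then complete (\<open>kr_decomposable_MR_complete_graph\<close>). For \<open>n \<ge> 4\<close> neither 0 nor 1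
  is enough (\<open>not_kr_decomposable_MR_cycle_graph\<close>).

  \<^bold>\<open>Upper bound.\<close> Read a product \<open>P = f\<^sub>1 \<cdots> f\<^sub>m\<close> from left to right. The preimage of an
  edge has at most two elements, so every \<open>f\<close> maps the oriented edges that it carries to
  edges injectively. Extend this partial injection to a permutation of all oriented edges: a
  first group follows the permutations, and a memory that is only ever kept or overwritten
  records for every oriented edge whether it is still the image of an edge under \<open>P\<close>, and if
  not, one of its ends that is known to lie outside the range of \<open>P\<close>. Remove from the vertex
  set the ends of all surviving edges and all points known to be outside the range. Of the
  ends of any edge at most one remains, so the remaining set is independent. As a map in the
  monoid identifies only adjacent points, it is injective on this set, and a second group can
  follow it there. A second memory of the same kind stores the fibres of \<open>P\<close> over all
  vertices: the fibre over a remaining point is transported, all others are computed from the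
  surviving edges. The fibres determine \<open>P\<close>, and both memories are bands, hence aperiodic. On a
  complete graph a map is injective or has at most one value, and one group is enough.

  \<^bold>\<open>Lower bound.\<close> Let \<open>S\<close> divide \<open>A\<^sub>1 \<wr> G \<wr> A\<^sub>0\<close>, and let \<open>e\<close> be an idempotent of \<open>S\<close> and \<open>r\<close> a
  unit of finite order. Among all lifts of elements of the \<open>L\<close>-class of \<open>e\<close> take one whose image
  \<open>B\<close> in the states of \<open>A\<^sub>0\<close> is as small as possible; it can be chosen such that a lift of \<open>r\<close>
  fixes \<open>B\<close> pointwise. An idempotent that is the product of an element of this \<open>L\<close>-class and a
  power of \<open>r\<close> then has a lift that maps \<open>B\<close> onto itself by minimality, and since \<open>A\<^sub>0\<close> is
  aperiodic this lift fixes \<open>B\<close> pointwise. Over a fixed point of \<open>B\<close> the coordinate in \<open>G\<close> is multiplicative, so it is trivial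
  for idempotents and for their products. Such products are thus controlled by \<open>A\<^sub>1\<close> alone and
  have eventually constant powers (\<open>span_of_idempotents_aperiodic\<close>).

  In a cycle on \<open>n \<ge> 4\<close> vertices let \<open>k\<close> be the integer part of \<open>n/2\<close>, let \<open>e\<close> be the identity
  on \<open>{0, 2, \<dots>, 2k - 2}\<close> and \<open>r\<close> the rotation by one step. Three idempotents, whose images are
  rotated copies of that set, each move points back by at most one step. Their product
  permutes the \<open>k \<ge> 2\<close> points \<open>0, 2, \<dots>, 2k - 2\<close> cyclically, so its powers are not eventually constant.
\<close>

(* The record field mult of monoids must stay accessible under its short name. *)
hide_const (open) Multiset.mult

section \<open>Isomorphic copies of wreath products\<close>

definition sgp_iso :: "'a sgp \<Rightarrow> 'b sgp \<Rightarrow> bool" where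
  "sgp_iso S T \<longleftrightarrow>
     (\<exists>\<psi>. bij_betw \<psi> (carrier S) (carrier T) \<and> \<psi> \<in> sgp_hom S T)"

lemma sgp_homD:
  assumes "h \<in> sgp_hom S T" "x \<in> carrier S"
  shows "h x \<in> carrier T"
    and "y \<in> carrier S \<Longrightarrow> h (x \<odot>\<^bsub>S\<^esub> y) = h x \<odot>\<^bsub>T\<^esub> h y"
  using assms by (auto simp: sgp_hom_def)

lemma finite_sgp_closed:
  "finite_sgp S \<Longrightarrow> x \<in> carrier S \<Longrightarrow> y \<in> carrier S \<Longrightarrow> x \<odot>\<^bsub>S\<^esub> y \<in> carrier S"
  by (simp add: finite_sgp_def)

lemma finite_sgp_assoc:
  "finite_sgp S \<Longrightarrow> x \<in> carrier S \<Longrightarrow> y \<in> carrier S \<Longrightarrow> z \<in> carrier S \<Longrightarrow>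
   x \<odot>\<^bsub>S\<^esub> y \<odot>\<^bsub>S\<^esub> z = x \<odot>\<^bsub>S\<^esub> (y \<odot>\<^bsub>S\<^esub> z)"
  by (simp add: finite_sgp_def)

text \<open>Finiteness includes being a genuine right action, which the record type does not enforce.\<close>

definition finite_tsgp :: "('x, 's) tsgp \<Rightarrow> bool" where
  "finite_tsgp P \<longleftrightarrow>
     finite (states P) \<and> finite_sgp (sgp_of P) \<and>
     (\<forall>x\<in>states P. \<forall>s\<in>carrier (sgp_of P). act P x s \<in> states P) \<and>
     (\<forall>x\<in>states P. \<forall>s\<in>carrier (sgp_of P). \<forall>t\<in>carrier (sgp_of P).
        act P x (s \<odot>\<^bsub>sgp_of P\<^esub> t) = act P (act P x s) t)"

lemma finite_tsgpD:
  assumes "finite_tsgp P"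
  shows "finite (states P)" "finite_sgp (sgp_of P)"
    and "x \<in> states P \<Longrightarrow> s \<in> carrier (sgp_of P) \<Longrightarrow> act P x s \<in> states P"
    and "x \<in> states P \<Longrightarrow> s \<in> carrier (sgp_of P) \<Longrightarrow> t \<in> carrier (sgp_of P) \<Longrightarrow>
      act P x (s \<odot>\<^bsub>sgp_of P\<^esub> t) = act P (act P x s) t"
  using assms by (auto simp: finite_tsgp_def)

lemma regular_simps [simp]:
  "sgp_of (regular S) = S"
  "act (regular S) (Some a) s = Some (a \<odot>\<^bsub>S\<^esub> s)"
  "act (regular S) None s = Some s"
  by (simp_all add: regular_def)

lemma states_regular_monoid:
  "has_identity S \<Longrightarrow> states (regular S) = Some ` carrier S"
  by (simp add: regular_def)

lemma finite_tsgp_regular: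
  assumes "finite_sgp S"
  shows "finite_tsgp (regular S)"
  using assms unfolding finite_tsgp_def
  by (auto simp: regular_def finite_sgp_def)

lemma wreath_simps [simp]:
  "states (wreath P Q) = states P \<times> states Q"
  "carrier (sgp_of (wreath P Q)) =
     (states Q \<rightarrow>\<^sub>E carrier (sgp_of P)) \<times> carrier (sgp_of Q)"
  "(f, t) \<odot>\<^bsub>sgp_of (wreath P Q)\<^esub> (g, u) =
     (\<lambda>y\<in>states Q. f y \<odot>\<^bsub>sgp_of P\<^esub> g (act Q y t), t \<odot>\<^bsub>sgp_of Q\<^esub> u)"
  "act (wreath P Q) (x, y) (f, t) = (act P x (f y), act Q y t)"
  by (simp_all add: wreath_def)

lemma finite_tsgp_wreath:
  assumes P: "finite_tsgp P" and Q: "finite_tsgp Q"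
  shows "finite_tsgp (wreath P Q)"
proof -
  note p = finite_tsgpD[OF P] and q = finite_tsgpD[OF Q]
  note pm = finite_sgp_closed[OF p(2)] finite_sgp_assoc[OF p(2)]
    and qm = finite_sgp_closed[OF q(2)] finite_sgp_assoc[OF q(2)]
  let ?W = "sgp_of (wreath P Q)"
  have ne: "carrier ?W \<noteq> {}"
    using p(2) q(2) by (auto simp: finite_sgp_def PiE_eq_empty_iff)
  have fin: "finite (carrier ?W)"
    using p(1,2) q(1,2) by (auto simp: finite_sgp_def intro!: finite_PiE)
  have "finite_sgp ?W"
    unfolding finite_sgp_def
  proof (intro conjI ballI fin ne)
    fix x y assume x: "x \<in> carrier ?W" and y: "y \<in> carrier ?W"
    obtain f t where [simp]: "x = (f, t)" by force
    obtain g u where [simp]: "y = (g, u)" by force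
    have f: "f w \<in> carrier (sgp_of P)" and g: "g w \<in> carrier (sgp_of P)"
      if "w \<in> states Q" for w
      using x y that by (auto dest: PiE_mem)
    have t: "t \<in> carrier (sgp_of Q)" and u: "u \<in> carrier (sgp_of Q)" using x y by auto
    show "x \<odot>\<^bsub>?W\<^esub> y \<in> carrier ?W"
      by (simp add: pm(1) qm(1) f g t u q(3))
    fix z assume z: "z \<in> carrier ?W"
    obtain h v where [simp]: "z = (h, v)" by force
    have h: "h w \<in> carrier (sgp_of P)" if "w \<in> states Q" for w
      using z that by (auto dest: PiE_mem)
    have v: "v \<in> carrier (sgp_of Q)" using z by auto
    show "x \<odot>\<^bsub>?W\<^esub> y \<odot>\<^bsub>?W\<^esub> z = x \<odot>\<^bsub>?W\<^esub> (y \<odot>\<^bsub>?W\<^esub> z)"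
      by (simp add: pm(2) qm f g h t u v q(3,4) cong: restrict_cong)
  qed
  moreover have "f w \<in> carrier (sgp_of P)"
    if "f \<in> states Q \<rightarrow>\<^sub>E carrier (sgp_of P)" "w \<in> states Q" for f w
    using that by auto
  ultimately show ?thesis
    unfolding finite_tsgp_def by (auto simp: p q)
qed

lemma tsgp_iso_trans:
  assumes "tsgp_iso P Q" "tsgp_iso Q R"
  shows "tsgp_iso P R"
proof -
  obtain a b where ab: "bij_betw a (states P) (states Q)"
    "bij_betw b (carrier (sgp_of P)) (carrier (sgp_of Q))" "b \<in> sgp_hom (sgp_of P) (sgp_of Q)"
    "\<forall>x\<in>states P. \<forall>s\<in>carrier (sgp_of P). a (act P x s) = act Q (a x) (b s)"
    using assms(1) by (auto simp: tsgp_iso_def)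
  obtain c d where cd: "bij_betw c (states Q) (states R)"
    "bij_betw d (carrier (sgp_of Q)) (carrier (sgp_of R))" "d \<in> sgp_hom (sgp_of Q) (sgp_of R)"
    "\<forall>x\<in>states Q. \<forall>s\<in>carrier (sgp_of Q). c (act Q x s) = act R (c x) (d s)"
    using assms(2) by (auto simp: tsgp_iso_def)
  have "bij_betw (c \<circ> a) (states P) (states R)"
    "bij_betw (d \<circ> b) (carrier (sgp_of P)) (carrier (sgp_of R))"
    using ab cd bij_betw_trans by blast+
  moreover have "d \<circ> b \<in> sgp_hom (sgp_of P) (sgp_of R)"
    using ab(3) cd(3) by (auto simp: sgp_hom_def Pi_iff)
  moreover have "\<forall>x\<in>states P. \<forall>s\<in>carrier (sgp_of P).
      (c \<circ> a) (act P x s) = act R ((c \<circ> a) x) ((d \<circ> b) s)"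
    using ab cd by (simp add: bij_betwE)
  ultimately show ?thesis unfolding tsgp_iso_def by blast
qed

lemma tsgp_iso_refl: "tsgp_iso P P"
  unfolding tsgp_iso_def
  by (intro exI[of _ id]) (auto simp: sgp_hom_def)

text \<open>For a monoid the states of the regular representation are the elements themselves, so the
  isomorphism also acts on states; all factors constructed below are monoids.\<close>

lemma tsgp_iso_regular:
  assumes iso: "sgp_iso S S'" and S: "has_identity S"
  shows "tsgp_iso (regular S) (regular S')"
proof -
  obtain \<psi> where bij: "bij_betw \<psi> (carrier S) (carrier S')" and hom: "\<psi> \<in> sgp_hom S S'"
    using iso by (auto simp: sgp_iso_def)
  have im: "\<psi> ` carrier S = carrier S'" using bij by (simp add: bij_betw_def)
  obtain e where e: "e \<in> carrier S" "\<forall>x\<in>carrier S. e \<odot>\<^bsub>S\<^esub> x = x \<and> x \<odot>\<^bsub>S\<^esub> e = x"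
    using S by (auto simp: has_identity_def)
  have S': "has_identity S'"
    unfolding has_identity_def
  proof (intro bexI ballI)
    show "\<psi> e \<in> carrier S'" using im e by blast
    fix x assume "x \<in> carrier S'"
    then obtain y where "y \<in> carrier S" "x = \<psi> y" using im by blast
    then show "\<psi> e \<odot>\<^bsub>S'\<^esub> x = x \<and> x \<odot>\<^bsub>S'\<^esub> \<psi> e = x"
      using sgp_homD(2)[OF hom] e by metis
  qed
  have "bij_betw (map_option \<psi>) (Some ` carrier S) (Some ` carrier S')"
    using bij unfolding bij_betw_def im[symmetric] by (auto simp: inj_on_def image_image)
  then show ?thesis
    unfolding tsgp_iso_def states_regular_monoid[OF S] states_regular_monoid[OF S'] regular_simps
    using bij hom sgp_homD(2)[OF hom]
    by (intro exI[of _ "map_option \<psi>"] exI[of _ \<psi>]) auto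
qed

text \<open>Isomorphisms of the factors transport a map of states of \<open>Q\<close> into the semigroup of \<open>P\<close> by
  conjugation. This allows the copies on natural numbers to be replaced by the original factors
  at every stage of an iterated wreath product.\<close>

lemma tsgp_iso_wreath:
  fixes P :: "('x, 's) tsgp" and Q :: "('y, 't) tsgp"
    and P' :: "('x1, 's1) tsgp" and Q' :: "('y1, 't1) tsgp"
  assumes PP: "tsgp_iso P P'" and QQ: "tsgp_iso Q Q'"
    and P: "finite_tsgp P" and Q: "finite_tsgp Q"
  shows "tsgp_iso (wreath P Q) (wreath P' Q')"
proof -
  obtain a b where ab: "bij_betw a (states P) (states P')"
    "bij_betw b (carrier (sgp_of P)) (carrier (sgp_of P'))" "b \<in> sgp_hom (sgp_of P) (sgp_of P')"
    "\<forall>x\<in>states P. \<forall>s\<in>carrier (sgp_of P). a (act P x s) = act P' (a x) (b s)"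
    using PP by (auto simp: tsgp_iso_def)
  obtain c d where cd: "bij_betw c (states Q) (states Q')"
    "bij_betw d (carrier (sgp_of Q)) (carrier (sgp_of Q'))" "d \<in> sgp_hom (sgp_of Q) (sgp_of Q')"
    "\<forall>x\<in>states Q. \<forall>s\<in>carrier (sgp_of Q). c (act Q x s) = act Q' (c x) (d s)"
    using QQ by (auto simp: tsgp_iso_def)
  let ?ci = "inv_into (states Q) c" and ?bi = "inv_into (carrier (sgp_of P)) b"
  have ci: "?ci (c y) = y" if "y \<in> states Q" for y
    using that cd(1) by (simp add: bij_betw_inv_into_left)
  have ci': "?ci y \<in> states Q" "c (?ci y) = y" if "y \<in> states Q'" for y
    using that cd(1) by (auto simp: bij_betw_inv_into_right bij_betw_def intro: inv_into_into)
  have c: "c y \<in> states Q'" if "y \<in> states Q" for y using that cd(1) bij_betwE by blast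
  have b: "b y \<in> carrier (sgp_of P')" "?bi (b y) = y" if "y \<in> carrier (sgp_of P)" for y
    using that ab(2) by (auto simp: bij_betwE bij_betw_inv_into_left)
  have bi: "?bi y \<in> carrier (sgp_of P)" "b (?bi y) = y" if "y \<in> carrier (sgp_of P')" for y
    using that ab(2) by (auto simp: bij_betw_inv_into_right bij_betw_def intro: inv_into_into)
  note Qa = finite_tsgpD(3)[OF Q]
  define \<Psi> where "\<Psi> = (\<lambda>f. \<lambda>y\<in>states Q'. b (f (?ci y)))"
  define \<Psi>i where "\<Psi>i = (\<lambda>f. \<lambda>y\<in>states Q. ?bi (f (c y)))"
  have Psi: "bij_betw \<Psi> (states Q \<rightarrow>\<^sub>E carrier (sgp_of P)) (states Q' \<rightarrow>\<^sub>E carrier (sgp_of P'))"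
  proof (rule bij_betw_byWitness[where f' = \<Psi>i])
    show "\<forall>f\<in>states Q \<rightarrow>\<^sub>E carrier (sgp_of P). \<Psi>i (\<Psi> f) = f"
    proof (intro ballI ext)
      fix f y assume f: "f \<in> states Q \<rightarrow>\<^sub>E carrier (sgp_of P)"
      show "\<Psi>i (\<Psi> f) y = f y"
        by (cases "y \<in> states Q")
          (simp_all add: \<Psi>_def \<Psi>i_def c ci b PiE_mem[OF f] PiE_arb[OF f])
    qed
    show "\<forall>f\<in>states Q' \<rightarrow>\<^sub>E carrier (sgp_of P'). \<Psi> (\<Psi>i f) = f"
    proof (intro ballI ext)
      fix f y assume f: "f \<in> states Q' \<rightarrow>\<^sub>E carrier (sgp_of P')"
      show "\<Psi> (\<Psi>i f) y = f y"
        by (cases "y \<in> states Q'")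
          (simp_all add: \<Psi>_def \<Psi>i_def ci' bi PiE_mem[OF f] PiE_arb[OF f])
    qed
    show "\<Psi> ` (states Q \<rightarrow>\<^sub>E carrier (sgp_of P)) \<subseteq> states Q' \<rightarrow>\<^sub>E carrier (sgp_of P')"
      unfolding \<Psi>_def by (intro image_subsetI restrict_PiE_iff[THEN iffD2] ballI b(1)) (rule PiE_mem, assumption, rule ci'(1))
    show "\<Psi>i ` (states Q' \<rightarrow>\<^sub>E carrier (sgp_of P')) \<subseteq> states Q \<rightarrow>\<^sub>E carrier (sgp_of P)"
      unfolding \<Psi>i_def by (intro image_subsetI restrict_PiE_iff[THEN iffD2] ballI bi(1)) (rule PiE_mem, assumption, rule c)
  qed
  show ?thesis
    unfolding tsgp_iso_def
  proof (intro exI conjI)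
    show "bij_betw (map_prod a c) (states (wreath P Q)) (states (wreath P' Q'))"
      using ab(1) cd(1) by (simp add: bij_betw_map_prod)
    show "bij_betw (map_prod \<Psi> d) (carrier (sgp_of (wreath P Q)))
       (carrier (sgp_of (wreath P' Q')))"
      using Psi cd(2) by (simp add: bij_betw_map_prod)
    show "map_prod \<Psi> d \<in> sgp_hom (sgp_of (wreath P Q)) (sgp_of (wreath P' Q'))"
      unfolding sgp_hom_def
    proof (intro CollectI conjI ballI)
      show "map_prod \<Psi> d \<in> carrier (sgp_of (wreath P Q)) \<rightarrow> carrier (sgp_of (wreath P' Q'))"
        using bij_betw_apply[OF Psi] bij_betw_apply[OF cd(2)] by (simp add: Pi_iff)
      fix x y assume x: "x \<in> carrier (sgp_of (wreath P Q))" and y: "y \<in> carrier (sgp_of (wreath P Q))"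
      obtain f t where [simp]: "x = (f, t)" by force
      obtain g u where [simp]: "y = (g, u)" by force
      have "act Q' z (d t) = c (act Q (?ci z) t)" if "z \<in> states Q'" for z
        using that x cd(4) by (simp add: ci')
      moreover have "f z \<in> carrier (sgp_of P)" "g z \<in> carrier (sgp_of P)" if "z \<in> states Q" for z
        using that x y by auto
      ultimately show "map_prod \<Psi> d (x \<odot>\<^bsub>sgp_of (wreath P Q)\<^esub> y) =
          map_prod \<Psi> d x \<odot>\<^bsub>sgp_of (wreath P' Q')\<^esub> map_prod \<Psi> d y"
        using x y
        by (simp add: sgp_homD(2)[OF cd(3)] sgp_homD(2)[OF ab(3)] \<Psi>_def
            ci ci' c Qa cong: restrict_cong)
    qed
    show "\<forall>x\<in>states (wreath P Q). \<forall>s\<in>carrier (sgp_of (wreath P Q)).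
       map_prod a c (act (wreath P Q) x s) = act (wreath P' Q') (map_prod a c x) (map_prod \<Psi> d s)"
      using ab(4) cd(4) by (auto simp: \<Psi>_def ci c dest: PiE_mem)
  qed
qed

lemma divides_iso:
  assumes iso: "sgp_iso T T'" and T: "finite_sgp T"
  shows "S \<prec>\<prec> T \<longleftrightarrow> S \<prec>\<prec> T'"
proof -
  obtain \<psi> where bij: "bij_betw \<psi> (carrier T) (carrier T')"
    and hom: "\<psi> \<in> sgp_hom T T'"
    using iso by (auto simp: sgp_iso_def)
  note hm = sgp_homD[OF hom] and cT = finite_sgp_closed[OF T]
  let ?i = "inv_into (carrier T) \<psi>"
  have inv: "?i (\<psi> x) = x" if "x \<in> carrier T" for x
    using that bij by (simp add: bij_betw_inv_into_left)
  show ?thesis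
  proof
    assume "S \<prec>\<prec> T"
    then obtain U h where U: "subsgp U T" and
      h: "h \<in> sgp_hom (T\<lparr>carrier := U\<rparr>) S" "h ` U = carrier S"
      by (auto simp: divides_def)
    have sub: "U \<subseteq> carrier T" using U by (simp add: subsgp_def)
    have cl: "x \<odot>\<^bsub>T\<^esub> y \<in> U" if "x \<in> U" "y \<in> U" for x y
      using U that by (simp add: subsgp_def)
    have mul: "\<psi> x \<odot>\<^bsub>T'\<^esub> \<psi> y = \<psi> (x \<odot>\<^bsub>T\<^esub> y)" if "x \<in> U" "y \<in> U" for x y
      using hm(2) sub that by (metis subsetD)
    have inv': "?i (\<psi> x) = x" if "x \<in> U" for x using inv sub that by blast
    show "S \<prec>\<prec> T'"
      unfolding divides_def
    proof (intro exI conjI)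
      show "subsgp (\<psi> ` U) T'"
        using U hm(1) sub by (auto simp: subsgp_def mul cl)
      show "h \<circ> ?i \<in> sgp_hom (T'\<lparr>carrier := \<psi> ` U\<rparr>) S"
        using h(1) by (auto simp: sgp_hom_def mul cl inv')
      show "(h \<circ> ?i) ` \<psi> ` U = carrier S"
        using h(2) inv' by (force simp: image_image)
    qed
  next
    assume "S \<prec>\<prec> T'"
    then obtain U h where U: "subsgp U T'" and
      h: "h \<in> sgp_hom (T'\<lparr>carrier := U\<rparr>) S" "h ` U = carrier S"
      by (auto simp: divides_def)
    let ?V = "{x \<in> carrier T. \<psi> x \<in> U}"
    have im: "\<psi> ` ?V = U"
      using U bij by (auto simp: subsgp_def bij_betw_def)
    show "S \<prec>\<prec> T"
      unfolding divides_def
    proof (intro exI conjI)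
      show "subsgp ?V T"
        using U im by (auto simp: subsgp_def cT hm(2))
      show "h \<circ> \<psi> \<in> sgp_hom (T\<lparr>carrier := ?V\<rparr>) S"
        using h(1) by (auto simp: sgp_hom_def hm(2))
      show "(h \<circ> \<psi>) ` ?V = carrier S"
        using h(2) im by (metis image_comp)
    qed
  qed
qed

lemma tsgp_iso_imp_sgp_iso: "tsgp_iso P Q \<Longrightarrow> sgp_iso (sgp_of P) (sgp_of Q)"
  by (auto simp: tsgp_iso_def sgp_iso_def)

lemma nat_copy_tsgp:
  fixes P :: "('x, 's) tsgp"
  assumes "finite_tsgp P"
  shows "\<exists>W :: (nat, nat) tsgp. tsgp_iso P W"
proof -
  note P = finite_tsgpD[OF assms]
  obtain c :: "'x \<Rightarrow> nat" where c: "inj_on c (states P)"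
    using P(1) by (metis finite_imp_inj_to_nat_seg)
  obtain d :: "'s \<Rightarrow> nat" where d: "inj_on d (carrier (sgp_of P))"
    using P(2) by (metis finite_sgp_def finite_imp_inj_to_nat_seg)
  let ?c = "inv_into (states P) c" and ?d = "inv_into (carrier (sgp_of P)) d"
  let ?W = "\<lparr>states = c ` states P,
     sgp_of = \<lparr>carrier = d ` carrier (sgp_of P), sgmult = \<lambda>x y. d (?d x \<odot>\<^bsub>sgp_of P\<^esub> ?d y)\<rparr>,
     act = \<lambda>x s. c (act P (?c x) (?d s))\<rparr> :: (nat, nat) tsgp"
  have "tsgp_iso P ?W"
    unfolding tsgp_iso_def
    by (intro exI[of _ c] exI[of _ d]) (auto simp: sgp_hom_def bij_betw_def c d)
  then show ?thesis by blast
qed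

lemma nat_copy_sgp:
  fixes S :: "'a sgp"
  assumes "finite_sgp S"
  shows "\<exists>S' :: nat sgp. sgp_iso S S'"
proof -
  from nat_copy_tsgp[OF finite_tsgp_regular[OF assms]]
  obtain W :: "(nat, nat) tsgp" where "tsgp_iso (regular S) W" by blast
  from tsgp_iso_imp_sgp_iso[OF this] show ?thesis by auto
qed

lemma finite_sgp_iso:
  assumes "sgp_iso S S'" "finite_sgp S"
  shows "finite_sgp S'"
proof -
  obtain \<psi> where bij: "bij_betw \<psi> (carrier S) (carrier S')" and hom: "\<psi> \<in> sgp_hom S S'"
    using assms(1) by (auto simp: sgp_iso_def)
  have im: "carrier S' = \<psi> ` carrier S" using bij by (simp add: bij_betw_def)
  have mul: "\<psi> x \<odot>\<^bsub>S'\<^esub> \<psi> y = \<psi> (x \<odot>\<^bsub>S\<^esub> y)" if "x \<in> carrier S" "y \<in> carrier S" for x y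
    using hom that by (simp add: sgp_hom_def)
  show ?thesis
    using assms(2) unfolding finite_sgp_def im by (auto simp: mul)
qed

lemma finite_tsgp_iso:
  assumes iso: "tsgp_iso P Q" and P: "finite_tsgp P"
  shows "finite_tsgp Q"
proof -
  note p = finite_tsgpD[OF P]
  obtain a b where ab: "bij_betw a (states P) (states Q)"
    "bij_betw b (carrier (sgp_of P)) (carrier (sgp_of Q))" "b \<in> sgp_hom (sgp_of P) (sgp_of Q)"
    "\<forall>x\<in>states P. \<forall>s\<in>carrier (sgp_of P). a (act P x s) = act Q (a x) (b s)"
    using iso by (auto simp: tsgp_iso_def)
  have im: "states Q = a ` states P" "carrier (sgp_of Q) = b ` carrier (sgp_of P)"
    using ab(1,2) by (simp_all add: bij_betw_def)
  have mul: "b x \<odot>\<^bsub>sgp_of Q\<^esub> b y = b (x \<odot>\<^bsub>sgp_of P\<^esub> y)"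
    if "x \<in> carrier (sgp_of P)" "y \<in> carrier (sgp_of P)" for x y
    using ab(3) that by (simp add: sgp_hom_def)
  have ac: "act Q (a x) (b s) = a (act P x s)"
    if "x \<in> states P" "s \<in> carrier (sgp_of P)" for x s
    using ab(4) that by simp
  show ?thesis
    using finite_sgp_iso[OF tsgp_iso_imp_sgp_iso[OF iso] p(2)] p(1)
    unfolding finite_tsgp_def im by (simp add: mul ac p(3,4) finite_sgp_closed[OF p(2)])
qed

text \<open>Lets wreath products be formed on their natural types while \<open>iter_wreath\<close> only speaks of
  copies on the natural numbers.\<close>

definition realizes :: "nat sgp list \<Rightarrow> ('x, 's) tsgp \<Rightarrow> bool" where
  "realizes Ss P \<longleftrightarrow> (\<exists>W. iter_wreath Ss W \<and> tsgp_iso P W)"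

lemma realizes_single:
  assumes "sgp_iso S S'" "finite_sgp S" "has_identity S"
  shows "realizes [S'] (regular S)"
proof -
  note i = tsgp_iso_regular[OF assms(1,3)]
  obtain W :: "(nat, nat) tsgp" where W: "tsgp_iso (regular S') W"
    using nat_copy_tsgp[OF finite_tsgp_iso[OF i finite_tsgp_regular[OF assms(2)]]] by blast
  show ?thesis
    unfolding realizes_def by (intro exI[of _ W] conjI iter_wreath.single[OF W] tsgp_iso_trans[OF i W])
qed

lemma realizes_Cons:
  assumes R: "realizes Ss Q" and Q: "finite_tsgp Q"
    and S: "sgp_iso S S'" "finite_sgp S" "has_identity S"
  shows "realizes (S' # Ss) (wreath (regular S) Q)"
proof -
  obtain V where V: "iter_wreath Ss V" "tsgp_iso Q V" using R by (auto simp: realizes_def)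
  note fS = finite_tsgp_regular[OF S(2)]
  have i: "tsgp_iso (wreath (regular S) Q) (wreath (regular S') V)"
    by (rule tsgp_iso_wreath[OF tsgp_iso_regular[OF S(1,3)] V(2) fS Q])
  obtain W :: "(nat, nat) tsgp" where W: "tsgp_iso (wreath (regular S') V) W"
    using nat_copy_tsgp[OF finite_tsgp_iso[OF i finite_tsgp_wreath[OF fS Q]]] by blast
  show ?thesis
    unfolding realizes_def by (intro exI[of _ W] conjI iter_wreath.cons[OF V(1) W] tsgp_iso_trans[OF i W])
qed

lemma iter_wreath_neq_Nil: "iter_wreath Ss W \<Longrightarrow> Ss \<noteq> []"
  by (induction rule: iter_wreath.induct) simp_all

lemma iter_wreath_single_iso:
  assumes "iter_wreath [S] W"
  shows "tsgp_iso (regular S) W"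
  using assms
proof (cases rule: iter_wreath.cases)
  case (cons V)
  then show ?thesis using iter_wreath_neq_Nil by blast
qed simp

lemma iter_wreath_Cons_iso:
  assumes "iter_wreath (S # T # Ss) W"
  obtains V where "iter_wreath (T # Ss) V" "tsgp_iso (wreath (regular S) V) W"
  using assms by (cases rule: iter_wreath.cases) auto

section \<open>Decompositions from factors on arbitrary types\<close>

text \<open>The law \<open>x\<^sup>3 = x\<^sup>2\<close> is a form of aperiodicity that is equational, hence easy to check and
  to transport; all aperiodic factors below satisfy it.\<close>

definition aperiodic_monoid :: "'a sgp \<Rightarrow> bool" where
  "aperiodic_monoid S \<longleftrightarrow> finite_sgp S \<and> has_identity S \<and>
     (\<forall>x\<in>carrier S. x \<odot>\<^bsub>S\<^esub> x \<odot>\<^bsub>S\<^esub> x = x \<odot>\<^bsub>S\<^esub> x)"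

definition finite_group :: "'a sgp \<Rightarrow> bool" where
  "finite_group S \<longleftrightarrow> finite_sgp S \<and> is_group S"

text \<open>In a subgroup the law can be cancelled to \<open>x = e\<close>.\<close>

lemma aperiodicI:
  assumes "\<And>x. x \<in> carrier S \<Longrightarrow> x \<odot>\<^bsub>S\<^esub> x \<odot>\<^bsub>S\<^esub> x = x \<odot>\<^bsub>S\<^esub> x"
  shows "aperiodic S"
  unfolding aperiodic_def
proof (intro allI impI)
  fix H assume H: "H \<subseteq> carrier S" "is_group (S\<lparr>carrier := H\<rparr>)"
  then obtain e where "group \<lparr>carrier = H, mult = sgmult S, one = e\<rparr>"
    by (auto simp: is_group_def)
  then interpret G: group "\<lparr>carrier = H, mult = sgmult S, one = e\<rparr>" .
  have e: "e \<in> H" using G.one_closed by simp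
  have "x = e" if x: "x \<in> H" for x
  proof -
    have xx: "x \<odot>\<^bsub>S\<^esub> x \<in> H" using G.m_closed x by simp
    have "x \<odot>\<^bsub>S\<^esub> x \<odot>\<^bsub>S\<^esub> x = x \<odot>\<^bsub>S\<^esub> x \<odot>\<^bsub>S\<^esub> e"
      using assms[of x] x H(1) G.r_one[of "x \<odot>\<^bsub>S\<^esub> x"] xx by auto
    then show ?thesis using G.Units_l_cancel[of "x \<odot>\<^bsub>S\<^esub> x" x e] G.Units_eq x xx e by simp
  qed
  then have "H = {e}" using e by blast
  then show "card H = 1" by simp
qed

lemma is_group_iso:
  assumes "sgp_iso S S'" "is_group S"
  shows "is_group S'"
proof -
  obtain \<psi> where im: "\<psi> ` carrier S = carrier S'" and hom: "\<psi> \<in> sgp_hom S S'"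
    using assms(1) by (auto simp: sgp_iso_def bij_betw_def)
  have mul: "\<psi> x \<odot>\<^bsub>S'\<^esub> \<psi> y = \<psi> (x \<odot>\<^bsub>S\<^esub> y)" if "x \<in> carrier S" "y \<in> carrier S" for x y
    using hom that by (simp add: sgp_hom_def)
  obtain e where "group \<lparr>carrier = carrier S, mult = sgmult S, one = e\<rparr>"
    using assms(2) by (auto simp: is_group_def)
  then interpret G: group "\<lparr>carrier = carrier S, mult = sgmult S, one = e\<rparr>" .
  have cl: "x \<odot>\<^bsub>S\<^esub> y \<in> carrier S" if "x \<in> carrier S" "y \<in> carrier S" for x y
    using that G.m_closed by simp
  have e: "e \<in> carrier S" "\<And>x. x \<in> carrier S \<Longrightarrow> e \<odot>\<^bsub>S\<^esub> x = x"
    using G.one_closed G.l_one by simp_all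
  have as: "x \<odot>\<^bsub>S\<^esub> y \<odot>\<^bsub>S\<^esub> z = x \<odot>\<^bsub>S\<^esub> (y \<odot>\<^bsub>S\<^esub> z)"
    if "x \<in> carrier S" "y \<in> carrier S" "z \<in> carrier S" for x y z
    using that G.m_assoc by simp
  have li: "\<exists>y\<in>carrier S. y \<odot>\<^bsub>S\<^esub> x = e" if "x \<in> carrier S" for x
    using that G.l_inv_ex by simp
  have "group \<lparr>carrier = carrier S', mult = sgmult S', one = \<psi> e\<rparr>"
  proof (rule groupI)
    fix x assume "x \<in> carrier \<lparr>carrier = carrier S', mult = sgmult S', one = \<psi> e\<rparr>"
    then obtain a where a: "a \<in> carrier S" "x = \<psi> a" using im by auto
    from li[OF a(1)] obtain b where "b \<in> carrier S" "b \<odot>\<^bsub>S\<^esub> a = e" by blast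
    then show "\<exists>y\<in>carrier \<lparr>carrier = carrier S', mult = sgmult S', one = \<psi> e\<rparr>.
        y \<otimes>\<^bsub>\<lparr>carrier = carrier S', mult = sgmult S', one = \<psi> e\<rparr>\<^esub> x =
        \<one>\<^bsub>\<lparr>carrier = carrier S', mult = sgmult S', one = \<psi> e\<rparr>\<^esub>"
      using a by (auto simp: im[symmetric] mul intro!: bexI[of _ b])
  qed (auto simp: im[symmetric] mul cl e as)
  then show ?thesis by (auto simp: is_group_def)
qed

lemma nat_copy_aperiodic_monoid:
  assumes "aperiodic_monoid S"
  obtains S' :: "nat sgp" where "sgp_iso S S'" "finite_sgp S'" "aperiodic S'"
proof -
  have S: "finite_sgp S" "\<And>x. x \<in> carrier S \<Longrightarrow> x \<odot>\<^bsub>S\<^esub> x \<odot>\<^bsub>S\<^esub> x = x \<odot>\<^bsub>S\<^esub> x"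
    using assms by (auto simp: aperiodic_monoid_def)
  obtain S' :: "nat sgp" where iso: "sgp_iso S S'" using nat_copy_sgp[OF S(1)] by blast
  then obtain \<psi> where im: "\<psi> ` carrier S = carrier S'" and hom: "\<psi> \<in> sgp_hom S S'"
    by (auto simp: sgp_iso_def bij_betw_def)
  have mul: "\<psi> x \<odot>\<^bsub>S'\<^esub> \<psi> y = \<psi> (x \<odot>\<^bsub>S\<^esub> y)" if "x \<in> carrier S" "y \<in> carrier S" for x y
    using hom that by (simp add: sgp_hom_def)
  have "aperiodic S'"
    by (rule aperiodicI) (auto simp: im[symmetric] mul finite_sgp_closed[OF S(1)] S(2))
  then show thesis using that iso finite_sgp_iso[OF iso S(1)] by blast
qed

lemma nat_copy_finite_group:
  assumes "finite_group S"
  obtains S' :: "nat sgp" where "sgp_iso S S'" "finite_sgp S'" "is_group S'"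
  using assms nat_copy_sgp finite_sgp_iso is_group_iso unfolding finite_group_def by metis

lemma has_identity_group:
  assumes "is_group S"
  shows "has_identity S"
proof -
  obtain e where "group \<lparr>carrier = carrier S, mult = sgmult S, one = e\<rparr>"
    using assms by (auto simp: is_group_def)
  then interpret G: group "\<lparr>carrier = carrier S, mult = sgmult S, one = e\<rparr>" .
  show ?thesis unfolding has_identity_def
    using G.one_closed G.l_one G.r_one by (auto intro!: bexI[of _ e])
qed

lemma kr_decomposable_1I:
  assumes A0: "aperiodic_monoid A0" and G1: "finite_group G1" and A1: "aperiodic_monoid A1"
    and S: "S \<prec>\<prec> sgp_of (wreath (regular A1) (wreath (regular G1) (regular A0)))"
  shows "kr_decomposable S 1"
proof -
  have f: "finite_sgp A0" "finite_sgp G1" "finite_sgp A1" "has_identity A0" "has_identity A1"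
    "has_identity G1"
    using A0 G1 A1 by (auto simp: aperiodic_monoid_def finite_group_def has_identity_group)
  obtain A0' :: "nat sgp" where A0': "sgp_iso A0 A0'" "finite_sgp A0'" "aperiodic A0'"
    using nat_copy_aperiodic_monoid[OF A0] .
  obtain G1' :: "nat sgp" where G1': "sgp_iso G1 G1'" "finite_sgp G1'" "is_group G1'"
    using nat_copy_finite_group[OF G1] .
  obtain A1' :: "nat sgp" where A1': "sgp_iso A1 A1'" "finite_sgp A1'" "aperiodic A1'"
    using nat_copy_aperiodic_monoid[OF A1] .
  note t0 = finite_tsgp_regular[OF f(1)]
  note t1 = finite_tsgp_wreath[OF finite_tsgp_regular[OF f(2)] t0]
  note t2 = finite_tsgp_wreath[OF finite_tsgp_regular[OF f(3)] t1]
  note r0 = realizes_single[OF A0'(1) f(1,4)]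
  note r1 = realizes_Cons[OF r0 t0 G1'(1) f(2,6)]
  note r2 = realizes_Cons[OF r1 t1 A1'(1) f(3,5)]
  obtain W where W: "iter_wreath [A1', G1', A0'] W"
    "tsgp_iso (wreath (regular A1) (wreath (regular G1) (regular A0))) W"
    using r2 unfolding realizes_def by blast
  have "S \<prec>\<prec> sgp_of W"
    using S divides_iso[OF tsgp_iso_imp_sgp_iso[OF W(2)] finite_tsgpD(2)[OF t2]] by blast
  then show ?thesis
    unfolding kr_decomposable_def using W(1) A0' G1' A1'
    by (intro exI[of _ "\<lambda>i. if i = 0 then A0' else A1'"] exI[of _ "\<lambda>_. G1'"] exI[of _ W]) auto
qed

lemma kr_decomposable_2I:
  assumes A0: "aperiodic_monoid A0" and G1: "finite_group G1" and A1: "aperiodic_monoid A1"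
    and G2: "finite_group G2" and A2: "aperiodic_monoid A2"
    and S: "S \<prec>\<prec> sgp_of (wreath (regular A2) (wreath (regular G2)
      (wreath (regular A1) (wreath (regular G1) (regular A0)))))"
  shows "kr_decomposable S 2"
proof -
  have f: "finite_sgp A0" "finite_sgp G1" "finite_sgp A1" "has_identity A0" "has_identity A1"
    "has_identity G1" "finite_sgp G2" "finite_sgp A2" "has_identity G2" "has_identity A2"
    using A0 G1 A1 G2 A2 by (auto simp: aperiodic_monoid_def finite_group_def has_identity_group)
  obtain A0' :: "nat sgp" where A0': "sgp_iso A0 A0'" "finite_sgp A0'" "aperiodic A0'"
    using nat_copy_aperiodic_monoid[OF A0] .
  obtain G1' :: "nat sgp" where G1': "sgp_iso G1 G1'" "finite_sgp G1'" "is_group G1'"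
    using nat_copy_finite_group[OF G1] .
  obtain A1' :: "nat sgp" where A1': "sgp_iso A1 A1'" "finite_sgp A1'" "aperiodic A1'"
    using nat_copy_aperiodic_monoid[OF A1] .
  obtain G2' :: "nat sgp" where G2': "sgp_iso G2 G2'" "finite_sgp G2'" "is_group G2'"
    using nat_copy_finite_group[OF G2] .
  obtain A2' :: "nat sgp" where A2': "sgp_iso A2 A2'" "finite_sgp A2'" "aperiodic A2'"
    using nat_copy_aperiodic_monoid[OF A2] .
  note t0 = finite_tsgp_regular[OF f(1)]
  note t1 = finite_tsgp_wreath[OF finite_tsgp_regular[OF f(2)] t0]
  note t2 = finite_tsgp_wreath[OF finite_tsgp_regular[OF f(3)] t1]
  note t3 = finite_tsgp_wreath[OF finite_tsgp_regular[OF f(7)] t2]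
  note t4 = finite_tsgp_wreath[OF finite_tsgp_regular[OF f(8)] t3]
  note r0 = realizes_single[OF A0'(1) f(1,4)]
  note r1 = realizes_Cons[OF r0 t0 G1'(1) f(2,6)]
  note r2 = realizes_Cons[OF r1 t1 A1'(1) f(3,5)]
  note r3 = realizes_Cons[OF r2 t2 G2'(1) f(7,9)]
  note r4 = realizes_Cons[OF r3 t3 A2'(1) f(8,10)]
  obtain W where W: "iter_wreath [A2', G2', A1', G1', A0'] W"
    "tsgp_iso (wreath (regular A2) (wreath (regular G2)
      (wreath (regular A1) (wreath (regular G1) (regular A0))))) W"
    using r4 unfolding realizes_def by blast
  have "S \<prec>\<prec> sgp_of W"
    using S divides_iso[OF tsgp_iso_imp_sgp_iso[OF W(2)] finite_tsgpD(2)[OF t4]] by blast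
  then show ?thesis
    unfolding kr_decomposable_def using W(1) A0' G1' A1' G2' A2'
    by (intro exI[of _ "\<lambda>i. if i = 0 then A0' else if i = 1 then A1' else A2'"]
        exI[of _ "\<lambda>i. if i = 1 then G1' else G2'"] exI[of _ W])
      (auto simp: numeral_2_eq_2)
qed

text \<open>A relation between states and elements of \<open>S\<close> says which element has been read so far. If
  every \<open>f\<close> has a lift that respects the relation, then the elements of the wreath product that
  simulate some element of \<open>S\<close> form a subsemigroup, and reading off the element simulated from
  the initial state is a homomorphism from it onto \<open>S\<close>. This is how both upper bounds are shown.\<close>

lemma divides_by_simulation:
  assumes P: "finite_tsgp P"
    and S: "finite_sgp S" "e \<in> carrier S" "\<And>x. x \<in> carrier S \<Longrightarrow> e \<odot>\<^bsub>S\<^esub> x = x"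
    and R: "R \<subseteq> states P \<times> carrier S"
    and fn: "\<And>y s t. (y, s) \<in> R \<Longrightarrow> (y, t) \<in> R \<Longrightarrow> s = t"
    and start: "(q, e) \<in> R"
    and step: "\<And>f. f \<in> carrier S \<Longrightarrow> \<exists>u\<in>carrier (sgp_of P).
      \<forall>(y, s)\<in>R. (act P y u, s \<odot>\<^bsub>S\<^esub> f) \<in> R"
  shows "S \<prec>\<prec> sgp_of P"
proof -
  note p = finite_tsgpD[OF P]
  let ?T = "sgp_of P"
  define sim where "sim u f \<longleftrightarrow> u \<in> carrier ?T \<and> f \<in> carrier S \<and>
    (\<forall>y s. (y, s) \<in> R \<longrightarrow> (act P y u, s \<odot>\<^bsub>S\<^esub> f) \<in> R)" for u f
  define U where "U = {u. \<exists>f. sim u f}"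
  define h where "h u = (THE f. sim u f)" for u
  have uniq: "f = g" if "sim u f" "sim u g" for u f g
  proof -
    have "(act P q u, f) \<in> R" "(act P q u, g) \<in> R"
      using that start S(3) unfolding sim_def by metis+
    then show ?thesis by (rule fn)
  qed
  have h: "h u = f" if "sim u f" for u f
    unfolding h_def using that uniq by blast
  have mult: "sim (u \<odot>\<^bsub>?T\<^esub> v) (f \<odot>\<^bsub>S\<^esub> g)" if "sim u f" "sim v g" for u v f g
    unfolding sim_def
  proof (intro conjI allI impI)
    show "u \<odot>\<^bsub>?T\<^esub> v \<in> carrier ?T" "f \<odot>\<^bsub>S\<^esub> g \<in> carrier S"
      using that finite_sgp_closed p(2) S(1) by (auto simp: sim_def)
    fix y s assume ys: "(y, s) \<in> R"
    then have c: "y \<in> states P" "s \<in> carrier S" using R by auto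
    have "(act P (act P y u) v, s \<odot>\<^bsub>S\<^esub> f \<odot>\<^bsub>S\<^esub> g) \<in> R"
      using that ys by (simp add: sim_def)
    then show "(act P y (u \<odot>\<^bsub>?T\<^esub> v), s \<odot>\<^bsub>S\<^esub> (f \<odot>\<^bsub>S\<^esub> g)) \<in> R"
      using that c p(4) finite_sgp_assoc[OF S(1)] by (simp add: sim_def)
  qed
  have lift: "\<exists>u. sim u f" if "f \<in> carrier S" for f
    using step[OF that] that unfolding sim_def by auto
  have "u \<in> carrier ?T" if "sim u f" for u f
    using that by (simp add: sim_def)
  then have "subsgp U ?T"
    unfolding subsgp_def U_def using lift[OF S(2)] mult by blast
  moreover have "h \<in> sgp_hom (?T\<lparr>carrier := U\<rparr>) S"
    using mult by (auto simp: sgp_hom_def U_def h) (auto simp: sim_def)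
  moreover have "h ` U = carrier S"
  proof
    show "h ` U \<subseteq> carrier S" by (auto simp: U_def h) (auto simp: sim_def)
    show "carrier S \<subseteq> h ` U"
    proof
      fix f assume "f \<in> carrier S"
      then obtain u where "sim u f" using lift by blast
      then show "f \<in> h ` U" using h by (force simp: U_def)
    qed
  qed
  ultimately show ?thesis unfolding divides_def by blast
qed

section \<open>Permutation groups and reset monoids\<close>

definition perm_sgp :: "'a set \<Rightarrow> ('a \<Rightarrow> 'a) sgp" where
  "perm_sgp X = \<lparr>carrier = {p. p permutes X}, sgmult = \<lambda>p q. q \<circ> p\<rparr>"

lemma perm_sgp_simps [simp]:
  "carrier (perm_sgp X) = {p. p permutes X}"
  "p \<odot>\<^bsub>perm_sgp X\<^esub> q = q \<circ> p"
  by (simp_all add: perm_sgp_def)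

lemma finite_group_perm_sgp:
  assumes "finite X"
  shows "finite_group (perm_sgp X)"
proof -
  have "group \<lparr>carrier = carrier (perm_sgp X), mult = sgmult (perm_sgp X), one = id\<rparr>"
  proof (rule groupI)
    fix p assume "p \<in> carrier \<lparr>carrier = carrier (perm_sgp X), mult = sgmult (perm_sgp X), one = id\<rparr>"
    then have p: "p permutes X" by simp
    then show "\<exists>q\<in>carrier \<lparr>carrier = carrier (perm_sgp X), mult = sgmult (perm_sgp X), one = id\<rparr>.
       q \<otimes>\<^bsub>\<lparr>carrier = carrier (perm_sgp X), mult = sgmult (perm_sgp X), one = id\<rparr>\<^esub> p =
       \<one>\<^bsub>\<lparr>carrier = carrier (perm_sgp X), mult = sgmult (perm_sgp X), one = id\<rparr>\<^esub>"
      by (intro bexI[of _ "inv_into UNIV p"]) (auto simp: permutes_inv permutes_inv_o)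
  qed (auto intro: permutes_compose simp: permutes_id o_assoc)
  moreover have "finite_sgp (perm_sgp X)"
    using assms permutes_id[of X]
    by (auto simp: finite_sgp_def finite_permutations permutes_compose o_assoc simp del: permutes_id)
  ultimately show ?thesis by (auto simp: finite_group_def is_group_def)
qed

text \<open>Memory cells indexed by \<open>L\<close> with contents in \<open>Q\<close>: an element overwrites the cells in its domain
  and keeps the others, so every element is idempotent.\<close>

definition reset_sgp :: "'a set \<Rightarrow> 'b set \<Rightarrow> ('a \<rightharpoonup> 'b) sgp" where
  "reset_sgp L Q = \<lparr>carrier = {c. dom c \<subseteq> L \<and> ran c \<subseteq> Q}, sgmult = (++)\<rparr>"

lemma reset_sgp_simps [simp]:
  "carrier (reset_sgp L Q) = {c. dom c \<subseteq> L \<and> ran c \<subseteq> Q}"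
  "c \<odot>\<^bsub>reset_sgp L Q\<^esub> d = c ++ d"
  by (simp_all add: reset_sgp_def)

lemma finite_partial_maps:
  assumes "finite L" "finite Q"
  shows "finite {c. dom c \<subseteq> L \<and> ran c \<subseteq> Q}"
proof (rule finite_subset)
  show "{c. dom c \<subseteq> L \<and> ran c \<subseteq> Q} \<subseteq> (\<Union>D\<in>Pow L. {c. dom c = D \<and> ran c \<subseteq> Q})" by auto
  show "finite (\<Union>D\<in>Pow L. {c. dom c = D \<and> ran c \<subseteq> Q})"
    using assms by (intro finite_UN_I finite_set_of_finite_maps) (auto intro: finite_subset)
qed

lemma ran_map_add_subset: "ran (c ++ d) \<subseteq> ran c \<union> ran d"
  by (auto simp: ran_def map_add_Some_iff)

lemma aperiodic_monoid_reset_sgp: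
  assumes "finite L" "finite Q"
  shows "aperiodic_monoid (reset_sgp L Q)"
proof -
  have closed: "dom (c ++ d) \<subseteq> L \<and> ran (c ++ d) \<subseteq> Q"
    if "dom c \<subseteq> L" "ran c \<subseteq> Q" "dom d \<subseteq> L" "ran d \<subseteq> Q" for c d
    using that ran_map_add_subset[of c d] by auto
  have "finite_sgp (reset_sgp L Q)"
    using closed finite_partial_maps[OF assms]
    unfolding finite_sgp_def reset_sgp_simps
  proof (intro conjI ballI)
    show "finite {c. dom c \<subseteq> L \<and> ran c \<subseteq> Q}" by (rule finite_partial_maps[OF assms])
    have "Map.empty \<in> {c. dom c \<subseteq> L \<and> ran c \<subseteq> Q}" by simp
    then show "{c. dom c \<subseteq> L \<and> ran c \<subseteq> Q} \<noteq> {}" by blast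
  qed (use closed in simp_all)
  moreover have "has_identity (reset_sgp L Q)"
    unfolding has_identity_def by (intro bexI[of _ Map.empty]) auto
  moreover have "c ++ c = c" for c :: "'a \<rightharpoonup> 'b"
    by (auto simp: map_add_def fun_eq_iff split: option.splits)
  ultimately show ?thesis by (simp add: aperiodic_monoid_def)
qed

abbreviation trivial_sgp :: "(unit \<rightharpoonup> unit) sgp" where
  "trivial_sgp \<equiv> reset_sgp {} {}"

lemma has_identity_reset_sgp: "has_identity (reset_sgp L Q)"
  unfolding has_identity_def by (intro bexI[of _ Map.empty]) auto

lemma has_identity_perm_sgp: "has_identity (perm_sgp X)"
  unfolding has_identity_def by (intro bexI[of _ id]) (auto simp: permutes_id)

lemma permutes_extends_inj_on:
  assumes X: "finite X" and D: "D \<subseteq> X" and f: "inj_on f D" "f ` D \<subseteq> X"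
  shows "\<exists>p. p permutes X \<and> (\<forall>x\<in>D. p x = f x)"
proof -
  have fin: "finite D" using X D finite_subset by blast
  have "card (X - D) = card (X - f ` D)"
    using f D fin X by (simp add: card_Diff_subset card_image)
  then obtain g where g: "bij_betw g (X - D) (X - f ` D)"
    using X finite_same_card_bij[of "X - D" "X - f ` D"] by auto
  define p where "p x = (if x \<in> D then f x else if x \<in> X then g x else x)" for x
  have "bij_betw p (D \<union> (X - D)) (f ` D \<union> (X - f ` D))"
  proof (rule bij_betw_combine)
    show "bij_betw p D (f ` D)"
      using f(1) by (auto simp: bij_betw_def inj_on_def p_def)
    show "bij_betw p (X - D) (X - f ` D)"
      using g by (rule bij_betw_cong[THEN iffD1, rotated]) (auto simp: p_def)
  qed auto
  moreover have "D \<union> (X - D) = X" "f ` D \<union> (X - f ` D) = X" using D f(2) by auto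
  ultimately have "bij_betw p X X" by simp
  then have "p permutes X" using D by (auto intro!: bij_imp_permutes simp: p_def)
  then show ?thesis by (auto simp: p_def intro!: exI[of _ p])
qed

section \<open>Preimages of vertices and edges\<close>

lemma MR_simps:
  "f \<odot>\<^bsub>MR \<Gamma>\<^esub> g = g \<circ>\<^sub>m f"
  by (simp add: MR_def)

lemma MR_vertex:
  assumes "f \<in> carrier (MR \<Gamma>)" "f x = Some a"
  shows "x \<in> fst \<Gamma>" "a \<in> fst \<Gamma>"
  using assms by (auto simp: MR_def ran_def)

lemma edge_vertices:
  assumes "finite_simple_graph \<Gamma>" "{a, b} \<in> snd \<Gamma>"
  shows "a \<in> fst \<Gamma>" "b \<in> fst \<Gamma>" "a \<noteq> b"
  using assms by (auto simp: finite_simple_graph_def)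

lemma simplex_pair:
  assumes G: "finite_simple_graph \<Gamma>" and s: "\<sigma> \<in> simplices \<Gamma>" "x \<in> \<sigma>" "y \<in> \<sigma>" "x \<noteq> y"
  shows "\<sigma> = {x, y} \<and> {x, y} \<in> snd \<Gamma>"
proof -
  have e: "\<sigma> \<in> snd \<Gamma>" using s by (auto simp: simplices_def)
  then have "card \<sigma> = 2" using G by (auto simp: finite_simple_graph_def)
  then have "\<sigma> = {x, y}" using s by (auto simp: card_2_iff)
  then show ?thesis using e by simp
qed

text \<open>The two preimages of the ends of an edge already fill up its preimage, which has at most two
  elements. Hence arcs are mapped injectively, and a point whose value is next to another value
  of the map is alone in its fibre.\<close>

lemma MR_edge_preimage:
  assumes G: "finite_simple_graph \<Gamma>" and f: "f \<in> carrier (MR \<Gamma>)"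
    and e: "{a, b} \<in> snd \<Gamma>" and xy: "f x = Some a" "f y = Some b"
  shows "{x, y} \<in> snd \<Gamma>" and "f z = Some a \<Longrightarrow> z = x" and "f z = Some b \<Longrightarrow> z = y"
proof -
  have ab: "a \<noteq> b" using edge_vertices[OF G e] by simp
  have "{a, b} \<in> simplices \<Gamma>" using e by (simp add: simplices_def)
  then have "full_preimage f {a, b} \<in> simplices \<Gamma> \<or> full_preimage f {a, b} = {}"
    using f by (simp add: MR_def)
  moreover have in_pre: "x \<in> full_preimage f {a, b}" "y \<in> full_preimage f {a, b}"
    using xy by (auto simp: full_preimage_def)
  ultimately have "full_preimage f {a, b} \<in> simplices \<Gamma>" by blast
  moreover have "x \<noteq> y" using xy ab by auto
  ultimately have pre: "full_preimage f {a, b} = {x, y} \<and> {x, y} \<in> snd \<Gamma>"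
    using simplex_pair[OF G _ in_pre] by blast
  then show "{x, y} \<in> snd \<Gamma>" by blast
  have "z \<in> {x, y}" if "f z = Some a \<or> f z = Some b"
    using that pre by (auto simp: full_preimage_def)
  then show "f z = Some a \<Longrightarrow> z = x" "f z = Some b \<Longrightarrow> z = y"
    using xy ab by auto
qed

text \<open>Only adjacent points can be identified.\<close>

lemma MR_fibre:
  assumes G: "finite_simple_graph \<Gamma>" and f: "f \<in> carrier (MR \<Gamma>)"
    and xy: "f x = Some a" "f y = Some a" "x \<noteq> y"
  shows "{x, y} \<in> snd \<Gamma>" and "f z = Some a \<Longrightarrow> z = x \<or> z = y"
proof -
  have "a \<in> fst \<Gamma>" using MR_vertex f xy by metis
  then have "{a} \<in> simplices \<Gamma>" by (simp add: simplices_def)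
  then have "full_preimage f {a} \<in> simplices \<Gamma> \<or> full_preimage f {a} = {}"
    using f by (simp add: MR_def)
  moreover have in_pre: "x \<in> full_preimage f {a}" "y \<in> full_preimage f {a}"
    using xy by (auto simp: full_preimage_def)
  ultimately have "full_preimage f {a} \<in> simplices \<Gamma>" by blast
  then have pre: "full_preimage f {a} = {x, y} \<and> {x, y} \<in> snd \<Gamma>"
    using simplex_pair[OF G _ in_pre] xy by blast
  then show "{x, y} \<in> snd \<Gamma>" by blast
  show "f z = Some a \<Longrightarrow> z = x \<or> z = y"
    using pre by (auto simp: full_preimage_def)
qed

lemma MR_identity:
  assumes "finite_simple_graph \<Gamma>"
  shows "(\<lambda>x. if x \<in> fst \<Gamma> then Some x else None) \<in> carrier (MR \<Gamma>)"
proof -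
  have "full_preimage (\<lambda>x. if x \<in> fst \<Gamma> then Some x else None) \<sigma> = \<sigma>" if "\<sigma> \<in> simplices \<Gamma>" for \<sigma>
    using that assms by (auto simp: full_preimage_def simplices_def finite_simple_graph_def split: if_splits)
  then show ?thesis by (auto simp: MR_def ran_def split: if_splits)
qed

section \<open>Two group levels suffice for every graph\<close>

definition arcs :: "'v graph \<Rightarrow> ('v \<times> 'v) set" where
  "arcs \<Gamma> = {(x, y). {x, y} \<in> snd \<Gamma>}"

text \<open>The arcs that \<open>f\<close> carries to arcs; on them \<open>f\<close> acts injectively.\<close>

definition rigid_arcs :: "'v graph \<Rightarrow> ('v \<rightharpoonup> 'v) \<Rightarrow> ('v \<times> 'v) set" where
  "rigid_arcs \<Gamma> f = {(x, y) \<in> arcs \<Gamma>. \<exists>a b. f x = Some a \<and> f y = Some b \<and> (a, b) \<in> arcs \<Gamma>}"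

definition arc_map :: "('v \<rightharpoonup> 'v) \<Rightarrow> 'v \<times> 'v \<Rightarrow> 'v \<times> 'v" where
  "arc_map f = (\<lambda>(x, y). (the (f x), the (f y)))"

definition arc_perm :: "'v graph \<Rightarrow> ('v \<rightharpoonup> 'v) \<Rightarrow> 'v \<times> 'v \<Rightarrow> 'v \<times> 'v" where
  "arc_perm \<Gamma> f = (SOME p. p permutes arcs \<Gamma> \<and> (\<forall>e\<in>rigid_arcs \<Gamma> f. p e = arc_map f e))"

lemma finite_arcs:
  assumes "finite_simple_graph \<Gamma>"
  shows "finite (arcs \<Gamma>)"
proof (rule finite_subset)
  show "arcs \<Gamma> \<subseteq> fst \<Gamma> \<times> fst \<Gamma>"
    using edge_vertices[OF assms] by (auto simp: arcs_def)
  show "finite (fst \<Gamma> \<times> fst \<Gamma>)" using assms by (simp add: finite_simple_graph_def)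
qed

lemma arc_perm:
  assumes G: "finite_simple_graph \<Gamma>" and f: "f \<in> carrier (MR \<Gamma>)"
  shows "arc_perm \<Gamma> f permutes arcs \<Gamma>"
    and "e \<in> rigid_arcs \<Gamma> f \<Longrightarrow> arc_perm \<Gamma> f e = arc_map f e"
proof -
  have "\<exists>p. p permutes arcs \<Gamma> \<and> (\<forall>e\<in>rigid_arcs \<Gamma> f. p e = arc_map f e)"
  proof (rule permutes_extends_inj_on)
    show "inj_on (arc_map f) (rigid_arcs \<Gamma> f)"
    proof (rule inj_onI)
      fix d e assume d: "d \<in> rigid_arcs \<Gamma> f" and e: "e \<in> rigid_arcs \<Gamma> f"
        and eq: "arc_map f d = arc_map f e"
      obtain x y a b where x: "d = (x, y)" "f x = Some a" "f y = Some b" "{a, b} \<in> snd \<Gamma>"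
        using d by (auto simp: rigid_arcs_def arcs_def)
      obtain x' y' a' b' where x': "e = (x', y')" "f x' = Some a'" "f y' = Some b'"
        using e by (auto simp: rigid_arcs_def)
      have "f x' = Some a" "f y' = Some b" using eq x x' by (auto simp: arc_map_def)
      then show "d = e"
        using MR_edge_preimage(2,3)[OF G f x(4,2,3)] x x' by blast
    qed
  qed (use finite_arcs[OF G] in \<open>auto simp: rigid_arcs_def arc_map_def\<close>)
  from someI_ex[OF this] show "arc_perm \<Gamma> f permutes arcs \<Gamma>"
    "e \<in> rigid_arcs \<Gamma> f \<Longrightarrow> arc_perm \<Gamma> f e = arc_map f e"
    unfolding arc_perm_def by blast+
qed

text \<open>Cells are indexed by initial arcs \<open>l\<close>, whose current position is \<open>g l\<close>. A cell is kept as long as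
  its position moves along with \<open>f\<close>. Otherwise the new position has an end outside the range of
  \<open>f\<close>, and the flag written says whether the first end is such a point; if it is not, then the
  second one is.\<close>

definition arc_update :: "'v graph \<Rightarrow> ('v \<rightharpoonup> 'v) \<Rightarrow> ('v \<times> 'v \<Rightarrow> 'v \<times> 'v) \<Rightarrow> 'v \<times> 'v \<rightharpoonup> bool"
  where
  "arc_update \<Gamma> f g = (\<lambda>l. if l \<in> arcs \<Gamma> \<and> g l \<notin> rigid_arcs \<Gamma> f
     then Some (fst (arc_perm \<Gamma> f (g l)) \<notin> ran f) else None)"

text \<open>Correctness of the first level for the product \<open>P\<close> read so far: an empty cell means that \<open>P\<close> maps
  the arc \<open>l\<close> to \<open>g l\<close>, a flag names an end of \<open>g l\<close> outside the range of \<open>P\<close>.\<close>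

definition arcs_tracked ::
  "'v graph \<Rightarrow> ('v \<rightharpoonup> 'v) \<Rightarrow> ('v \<times> 'v \<Rightarrow> 'v \<times> 'v) \<Rightarrow> ('v \<times> 'v \<rightharpoonup> bool) \<Rightarrow> bool" where
  "arcs_tracked \<Gamma> P g c \<longleftrightarrow>
     (\<forall>l\<in>arcs \<Gamma>. case c l of
        None \<Rightarrow> P (fst l) = Some (fst (g l)) \<and> P (snd l) = Some (snd (g l))
      | Some d \<Rightarrow> (if d then fst (g l) else snd (g l)) \<notin> ran P)"

text \<open>For an arc carried along by \<open>f\<close>, its new ends have a single preimage each under \<open>f\<close>, so an end
  missed by \<open>P\<close> leads to an end missed by \<open>P\<close> followed by \<open>f\<close>. An arc that is not the image of an
  arc has an end outside the range of \<open>f\<close>, because two values of \<open>f\<close> at its ends would come from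
  an edge.\<close>

lemma arcs_tracked_step:
  assumes G: "finite_simple_graph \<Gamma>" and f: "f \<in> carrier (MR \<Gamma>)"
    and g: "g permutes arcs \<Gamma>" and tr: "arcs_tracked \<Gamma> P g c"
  shows "arcs_tracked \<Gamma> (f \<circ>\<^sub>m P) (arc_perm \<Gamma> f \<circ> g) (c ++ arc_update \<Gamma> f g)"
  unfolding arcs_tracked_def
proof
  fix l assume l: "l \<in> arcs \<Gamma>"
  obtain a b where ab: "g l = (a, b)" by force
  have arc: "(a, b) \<in> arcs \<Gamma>" using l permutes_in_image[OF g, of l] ab by simp
  obtain a' b' where ab': "arc_perm \<Gamma> f (a, b) = (a', b')" by force
  have arc': "{a', b'} \<in> snd \<Gamma>"
    using arc permutes_in_image[OF arc_perm(1)[OF G f], of "(a, b)"] ab' by (simp add: arcs_def)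
  have sub: "ran (f \<circ>\<^sub>m P) \<subseteq> ran f"
    by (auto simp: ran_def map_comp_Some_iff)
  note c = tr[unfolded arcs_tracked_def, rule_format, OF l]
  show "case (c ++ arc_update \<Gamma> f g) l of
      None \<Rightarrow> (f \<circ>\<^sub>m P) (fst l) = Some (fst ((arc_perm \<Gamma> f \<circ> g) l)) \<and>
        (f \<circ>\<^sub>m P) (snd l) = Some (snd ((arc_perm \<Gamma> f \<circ> g) l))
    | Some d \<Rightarrow> (if d then fst ((arc_perm \<Gamma> f \<circ> g) l) else snd ((arc_perm \<Gamma> f \<circ> g) l))
        \<notin> ran (f \<circ>\<^sub>m P)"
  proof (cases "(a, b) \<in> rigid_arcs \<Gamma> f")
    case True
    then have fab: "f a = Some a'" "f b = Some b'"
      using arc_perm(2)[OF G f True] ab' by (auto simp: rigid_arcs_def arc_map_def)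
    have "a' \<notin> ran (f \<circ>\<^sub>m P)" if "a \<notin> ran P"
      using that MR_edge_preimage(2)[OF G f arc' fab]
      by (auto simp: ran_def map_comp_Some_iff)
    moreover have "b' \<notin> ran (f \<circ>\<^sub>m P)" if "b \<notin> ran P"
      using that MR_edge_preimage(3)[OF G f arc' fab]
      by (auto simp: ran_def map_comp_Some_iff)
    ultimately show ?thesis
      using c True fab
      by (auto simp: arc_update_def ab ab' map_add_def map_comp_Some_iff split: option.splits)
  next
    case False
    have "a' \<notin> ran f \<or> b' \<notin> ran f"
    proof (rule ccontr)
      assume "\<not> ?thesis"
      then obtain x y where xy: "f x = Some a'" "f y = Some b'" by (auto simp: ran_def)
      have "(x, y) \<in> rigid_arcs \<Gamma> f"
        using MR_edge_preimage(1)[OF G f arc' xy] xy arc' by (auto simp: rigid_arcs_def arcs_def)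
      moreover from arc_perm(2)[OF G f this] have "arc_perm \<Gamma> f (x, y) = arc_perm \<Gamma> f (a, b)"
        using xy ab' by (simp add: arc_map_def)
      ultimately show False
        using False permutes_inj[OF arc_perm(1)[OF G f]] by (metis injD)
    qed
    then show ?thesis
      using False l sub by (auto simp: arc_update_def ab ab' map_add_def)
  qed
qed

text \<open>Together with \<open>missing_points\<close> this is what the first level knows about the range of \<open>P\<close>: the
  points on images of arcs, and points certainly outside the range. The remaining
  \<open>free_points\<close> may lie inside or outside the range.\<close>

definition live_points :: "'v graph \<Rightarrow> ('v \<times> 'v \<Rightarrow> 'v \<times> 'v) \<Rightarrow> ('v \<times> 'v \<rightharpoonup> bool) \<Rightarrow> 'v set" where
  "live_points \<Gamma> g c = {a. \<exists>l\<in>arcs \<Gamma>. c l = None \<and> fst (g l) = a}"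

definition missing_points :: "'v graph \<Rightarrow> ('v \<times> 'v \<Rightarrow> 'v \<times> 'v) \<Rightarrow> ('v \<times> 'v \<rightharpoonup> bool) \<Rightarrow> 'v set" where
  "missing_points \<Gamma> g c = {a. \<exists>l\<in>arcs \<Gamma>. \<exists>d. c l = Some d \<and> a = (if d then fst (g l) else snd (g l))}"

definition free_points :: "'v graph \<Rightarrow> ('v \<times> 'v \<Rightarrow> 'v \<times> 'v) \<Rightarrow> ('v \<times> 'v \<rightharpoonup> bool) \<Rightarrow> 'v set" where
  "free_points \<Gamma> g c = fst \<Gamma> - live_points \<Gamma> g c - missing_points \<Gamma> g c"

text \<open>The cell of the arc from a free point to its neighbour cannot be empty, and it cannot flag the
  free point, so it flags the neighbour. In particular free points are pairwise non-adjacent.\<close>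

lemma neighbour_of_free_is_missing:
  assumes g: "g permutes arcs \<Gamma>" and v: "v \<in> free_points \<Gamma> g c" and e: "{v, w} \<in> snd \<Gamma>"
  shows "w \<in> missing_points \<Gamma> g c"
proof -
  obtain l where l: "l \<in> arcs \<Gamma>" "g l = (v, w)"
    using e permutes_image[OF g] by (auto simp: arcs_def image_iff set_eq_iff) metis
  show ?thesis
  proof (cases "c l")
    case None
    then have "v \<in> live_points \<Gamma> g c" using l by (auto simp: live_points_def)
    then show ?thesis using v by (simp add: free_points_def)
  next
    case (Some d)
    have "(if d then v else w) \<in> missing_points \<Gamma> g c"
      unfolding missing_points_def using l Some by (intro CollectI bexI[of _ l] exI[of _ d]) simp_all
    then show ?thesis using v by (cases d) (simp_all add: free_points_def)
  qed
qed

lemma missing_not_in_ran: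
  assumes tr: "arcs_tracked \<Gamma> P g c" and v: "v \<in> missing_points \<Gamma> g c"
  shows "v \<notin> ran P"
proof -
  obtain l d where "l \<in> arcs \<Gamma>" "c l = Some d" "v = (if d then fst (g l) else snd (g l))"
    using v unfolding missing_points_def by blast
  then show ?thesis using bspec[OF tr[unfolded arcs_tracked_def], of l] by simp
qed

text \<open>The fibre of \<open>P\<close> over an end of a surviving arc is a single point, so the first level can compute
  it.\<close>

lemma live_fibre:
  assumes G: "finite_simple_graph \<Gamma>" and P: "P \<in> carrier (MR \<Gamma>)"
    and g: "g permutes arcs \<Gamma>" and tr: "arcs_tracked \<Gamma> P g c" and v: "v \<in> live_points \<Gamma> g c"
    and x: "P x = Some v"
  shows "\<exists>m\<in>arcs \<Gamma>. c m = None \<and> fst (g m) = v \<and> fst m = x"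
proof -
  obtain l where l: "l \<in> arcs \<Gamma>" "c l = None" "fst (g l) = v" using v by (auto simp: live_points_def)
  have "P (fst l) = Some (fst (g l)) \<and> P (snd l) = Some (snd (g l))"
    using tr l by (auto simp: arcs_tracked_def split: option.splits)
  moreover have "{fst (g l), snd (g l)} \<in> snd \<Gamma>"
    using l(1) permutes_in_image[OF g, of l] by (auto simp: arcs_def case_prod_beta)
  ultimately have "x = fst l"
    using MR_edge_preimage(2)[OF G P] l(3) x by blast
  then show ?thesis using l by blast
qed

text \<open>Exists because \<open>f\<close> identifies only adjacent points and free points are not adjacent. It depends
  on the state of the first level only through the set of free points.\<close>

definition vertex_perm ::
  "'v graph \<Rightarrow> ('v \<rightharpoonup> 'v) \<Rightarrow> ('v \<times> 'v \<Rightarrow> 'v \<times> 'v) \<Rightarrow> ('v \<times> 'v \<rightharpoonup> bool) \<Rightarrow> 'v \<Rightarrow> 'v" where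
  "vertex_perm \<Gamma> f g c =
     (SOME h. h permutes fst \<Gamma> \<and> (\<forall>v\<in>free_points \<Gamma> g c \<inter> dom f. h v = the (f v)))"

lemma vertex_perm:
  assumes G: "finite_simple_graph \<Gamma>" and f: "f \<in> carrier (MR \<Gamma>)" and g: "g permutes arcs \<Gamma>"
  shows "vertex_perm \<Gamma> f g c permutes fst \<Gamma>"
    and "v \<in> free_points \<Gamma> g c \<Longrightarrow> f v = Some w \<Longrightarrow> vertex_perm \<Gamma> f g c v = w"
proof -
  have "\<exists>h. h permutes fst \<Gamma> \<and> (\<forall>v\<in>free_points \<Gamma> g c \<inter> dom f. h v = the (f v))"
  proof (rule permutes_extends_inj_on)
    show "inj_on (\<lambda>v. the (f v)) (free_points \<Gamma> g c \<inter> dom f)"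
    proof (rule inj_onI, rule ccontr)
      fix v w assume v: "v \<in> free_points \<Gamma> g c \<inter> dom f" and w: "w \<in> free_points \<Gamma> g c \<inter> dom f"
        and eq: "the (f v) = the (f w)" and ne: "v \<noteq> w"
      have "f v = Some (the (f v))" "f w = Some (the (f v))" using v w eq by auto
      from MR_fibre(1)[OF G f this ne] have "{v, w} \<in> snd \<Gamma>" .
      with neighbour_of_free_is_missing[OF g, where v = v and c = c and w = w] v have "w \<in> missing_points \<Gamma> g c" by blast
      then show False using w by (simp add: free_points_def)
    qed
    show "(\<lambda>v. the (f v)) ` (free_points \<Gamma> g c \<inter> dom f) \<subseteq> fst \<Gamma>"
      using MR_vertex(2)[OF f] by auto
  qed (use G in \<open>auto simp: free_points_def finite_simple_graph_def\<close>)
  from someI_ex[OF this] show "vertex_perm \<Gamma> f g c permutes fst \<Gamma>"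
    "v \<in> free_points \<Gamma> g c \<Longrightarrow> f v = Some w \<Longrightarrow> vertex_perm \<Gamma> f g c v = w"
    unfolding vertex_perm_def[symmetric] by (blast, force)
qed

text \<open>Cells are indexed by initial vertices \<open>l\<close> with current position \<open>k l\<close>. If \<open>f\<close> moves the free point
  \<open>k l\<close>, its fibre is kept. In all other cases the fibre over the new position consists of the
  points that \<open>P\<close> sends to ends of surviving arcs, and is computed from the first level.\<close>

definition fibre_update :: "'v graph \<Rightarrow> ('v \<rightharpoonup> 'v) \<Rightarrow> ('v \<times> 'v \<Rightarrow> 'v \<times> 'v) \<Rightarrow>
    ('v \<times> 'v \<rightharpoonup> bool) \<Rightarrow> ('v \<Rightarrow> 'v) \<Rightarrow> 'v \<rightharpoonup> 'v set" where
  "fibre_update \<Gamma> f g c k = (\<lambda>l. if l \<in> fst \<Gamma> \<and> k l \<notin> free_points \<Gamma> g c \<inter> dom f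
     then Some {fst m | m. m \<in> arcs \<Gamma> \<and> c m = None \<and>
       f (fst (g m)) = Some (vertex_perm \<Gamma> f g c (k l))} else None)"

text \<open>An empty cell stands for the initial fibre of the identity, the point \<open>l\<close> itself.\<close>

definition fibres_tracked ::
  "'v graph \<Rightarrow> ('v \<rightharpoonup> 'v) \<Rightarrow> ('v \<Rightarrow> 'v) \<Rightarrow> ('v \<rightharpoonup> 'v set) \<Rightarrow> bool" where
  "fibres_tracked \<Gamma> P k d \<longleftrightarrow>
     (\<forall>l\<in>fst \<Gamma>. {x. P x = Some (k l)} = (case d l of None \<Rightarrow> {l} | Some X \<Rightarrow> X))"

text \<open>If \<open>f\<close> identifies a free point with another point, the latter is a neighbour and hence outside
  the range of \<open>P\<close>, so the fibre does not change. If the new position is not reached from the free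
  point assigned to it, it is not reached from any free point, since the permutation agrees with
  \<open>f\<close> on all of them; thus only ends of surviving arcs contribute.\<close>

lemma fibres_tracked_step:
  assumes G: "finite_simple_graph \<Gamma>" and f: "f \<in> carrier (MR \<Gamma>)" and P: "P \<in> carrier (MR \<Gamma>)"
    and g: "g permutes arcs \<Gamma>" and k: "k permutes fst \<Gamma>"
    and tr: "arcs_tracked \<Gamma> P g c" and fib: "fibres_tracked \<Gamma> P k d"
  shows "fibres_tracked \<Gamma> (f \<circ>\<^sub>m P) (vertex_perm \<Gamma> f g c \<circ> k) (d ++ fibre_update \<Gamma> f g c k)"
  unfolding fibres_tracked_def
proof
  fix l assume l: "l \<in> fst \<Gamma>"
  let ?h = "vertex_perm \<Gamma> f g c"
  note h = vertex_perm[OF G f g, where c = c]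
  note d = fib[unfolded fibres_tracked_def, rule_format, OF l]
  show "{x. (f \<circ>\<^sub>m P) x = Some ((?h \<circ> k) l)} =
      (case (d ++ fibre_update \<Gamma> f g c k) l of None \<Rightarrow> {l} | Some X \<Rightarrow> X)"
  proof (cases "k l \<in> free_points \<Gamma> g c \<inter> dom f")
    case True
    then have free_points: "k l \<in> free_points \<Gamma> g c" and fk: "f (k l) = Some (?h (k l))"
      using h(2) by auto
    have "v = k l" if "P x = Some v" "f v = Some (?h (k l))" for x v
    proof (rule ccontr)
      assume "v \<noteq> k l"
      then have "{k l, v} \<in> snd \<Gamma>" using MR_fibre(1)[OF G f fk that(2)] by blast
      then have "v \<in> missing_points \<Gamma> g c" using neighbour_of_free_is_missing[OF g free_points] by blast
      then show False using missing_not_in_ran[OF tr] that(1) by (auto simp: ran_def)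
    qed
    then have "{x. (f \<circ>\<^sub>m P) x = Some (?h (k l))} = {x. P x = Some (k l)}"
      using fk by (auto simp: map_comp_Some_iff)
    moreover have "fibre_update \<Gamma> f g c k l = None" using True by (simp add: fibre_update_def)
    ultimately show ?thesis using d by (simp add: map_add_def)
  next
    case False
    have "{x. (f \<circ>\<^sub>m P) x = Some (?h (k l))} =
        {fst m | m. m \<in> arcs \<Gamma> \<and> c m = None \<and> f (fst (g m)) = Some (?h (k l))}" (is "?L = ?R")
    proof (intro equalityI subsetI)
      fix x assume "x \<in> ?L"
      then obtain v where v: "P x = Some v" "f v = Some (?h (k l))"
        by (auto simp: map_comp_Some_iff)
      have "v \<notin> free_points \<Gamma> g c"
      proof
        assume "v \<in> free_points \<Gamma> g c"
        then have "?h v = ?h (k l)" "v \<in> free_points \<Gamma> g c \<inter> dom f" using h(2) v(2) by auto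
        then show False using False permutes_inj[OF h(1)] by (metis injD)
      qed
      moreover have "v \<notin> missing_points \<Gamma> g c" using missing_not_in_ran[OF tr] v(1) by (auto simp: ran_def)
      ultimately have "v \<in> live_points \<Gamma> g c" using MR_vertex(2)[OF P v(1)] by (auto simp: free_points_def)
      then show "x \<in> ?R" using live_fibre[OF G P g tr _ v(1)] v(2) by force
    next
      fix x assume "x \<in> ?R"
      then obtain m where m: "m \<in> arcs \<Gamma>" "c m = None" "f (fst (g m)) = Some (?h (k l))" "x = fst m"
        by blast
      then have "P x = Some (fst (g m))"
        using tr by (auto simp: arcs_tracked_def split: option.splits)
      then show "x \<in> ?L" using m by (simp add: map_comp_Some_iff)
    qed
    then show ?thesis using False l by (simp add: fibre_update_def map_add_def)
  qed
qed

lemma fibres_tracked_unique: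
  assumes k: "k permutes fst \<Gamma>" and P: "P \<in> carrier (MR \<Gamma>)" "P' \<in> carrier (MR \<Gamma>)"
    and fib: "fibres_tracked \<Gamma> P k d" "fibres_tracked \<Gamma> P' k d"
  shows "P = P'"
proof -
  have iff: "P x = Some w \<longleftrightarrow> P' x = Some w" if "w \<in> fst \<Gamma>" for x w
  proof -
    have "w \<in> k ` fst \<Gamma>" using that by (simp add: permutes_image[OF k])
    then obtain l where l: "l \<in> fst \<Gamma>" "w = k l" by blast
    have "{x. P x = Some w} = {x. P' x = Some w}"
      using fib[unfolded fibres_tracked_def, THEN bspec, OF l(1)] l(2) by simp
    then show ?thesis by blast
  qed
  show ?thesis
  proof
    fix x
    show "P x = P' x"
    proof (cases "P x")
      case None
      then show ?thesis using iff[of _ x] MR_vertex(2)[OF P(2), of x] by (metis option.exhaust)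
    next
      case (Some w)
      then show ?thesis using iff MR_vertex(2)[OF P(1) Some] by simp
    qed
  qed
qed

text \<open>The bottom aperiodic factor is trivial. The two levels are, from the right, the permutations of
  arcs with the flags, and the permutations of vertices with the fibres.\<close>

theorem kr_decomposable_MR:
  assumes G: "finite_simple_graph \<Gamma>"
  shows "kr_decomposable (MR \<Gamma>) 2"
proof -
  have V: "finite (fst \<Gamma>)" using G by (simp add: finite_simple_graph_def)
  let ?V = "fst \<Gamma>" and ?E = "arcs \<Gamma>"
  let ?A1 = "reset_sgp ?E (UNIV :: bool set)" and ?A2 = "reset_sgp ?V (Pow ?V)"
  let ?G1 = "perm_sgp ?E" and ?G2 = "perm_sgp ?V"
  define W1 where "W1 = wreath (regular ?G1) (regular trivial_sgp)"
  define W2 where "W2 = wreath (regular ?A1) W1"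
  define W3 where "W3 = wreath (regular ?G2) W2"
  define W4 where "W4 = wreath (regular ?A2) W3"
  have A: "aperiodic_monoid trivial_sgp" "aperiodic_monoid ?A1" "aperiodic_monoid ?A2"
    "finite_group ?G1" "finite_group ?G2"
    using V finite_arcs[OF G] by (simp_all add: aperiodic_monoid_reset_sgp finite_group_perm_sgp)
  have fin: "finite_tsgp W4"
    unfolding W4_def W3_def W2_def W1_def
    using A by (intro finite_tsgp_wreath finite_tsgp_regular)
      (auto simp: aperiodic_monoid_def finite_group_def)
  have st1: "states W1 = Some ` {g. g permutes ?E} \<times> {Some Map.empty}"
    by (auto simp: W1_def states_regular_monoid has_identity_reset_sgp has_identity_perm_sgp)
  have st2: "states W2 = Some ` {c. dom c \<subseteq> ?E} \<times> states W1"
    by (auto simp: W2_def states_regular_monoid has_identity_reset_sgp)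
  have st3: "states W3 = Some ` {k. k permutes ?V} \<times> states W2"
    by (auto simp: W3_def states_regular_monoid has_identity_perm_sgp)
  have st4: "states W4 = Some ` {d. dom d \<subseteq> ?V \<and> ran d \<subseteq> Pow ?V} \<times> states W3"
    by (auto simp: W4_def states_regular_monoid has_identity_reset_sgp)
  let ?id = "\<lambda>x. if x \<in> ?V then Some x else None"
  define R where "R = {((Some d, Some k, Some c, Some g, Some (Map.empty :: unit \<rightharpoonup> unit)), P) | d k c g P.
    dom d \<subseteq> ?V \<and> ran d \<subseteq> Pow ?V \<and> k permutes ?V \<and> dom c \<subseteq> ?E \<and> g permutes ?E \<and>
    P \<in> carrier (MR \<Gamma>) \<and> arcs_tracked \<Gamma> P g c \<and> fibres_tracked \<Gamma> P k d}"
  have "MR \<Gamma> \<prec>\<prec> sgp_of W4"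
  proof (rule divides_by_simulation[OF fin finite_sgp_MR[OF G] MR_identity[OF G],
        where R = R and q = "(Some Map.empty, Some id, Some Map.empty, Some id, Some Map.empty)"])
    show "?id \<odot>\<^bsub>MR \<Gamma>\<^esub> f = f" if "f \<in> carrier (MR \<Gamma>)" for f
    proof
      fix x
      show "(?id \<odot>\<^bsub>MR \<Gamma>\<^esub> f) x = f x"
        using MR_vertex(1)[OF that, of x] by (cases "f x") (auto simp: MR_simps map_comp_def)
    qed
    show "R \<subseteq> states W4 \<times> carrier (MR \<Gamma>)"
      by (auto simp: R_def st4 st3 st2 st1)
    show "s = t" if "(y, s) \<in> R" "(y, t) \<in> R" for y s t
      using that unfolding R_def by (auto intro: fibres_tracked_unique[where \<Gamma> = \<Gamma>])
    show "((Some Map.empty, Some id, Some Map.empty, Some id, Some Map.empty), ?id) \<in> R"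
      using MR_identity[OF G] edge_vertices[OF G]
      by (auto simp: R_def permutes_id arcs_tracked_def fibres_tracked_def arcs_def split: if_splits)
    fix f assume f: "f \<in> carrier (MR \<Gamma>)"
    define u1 where "u1 = (\<lambda>y\<in>states (regular trivial_sgp). arc_perm \<Gamma> f)"
    define u2 where "u2 = (\<lambda>y\<in>states W1. arc_update \<Gamma> f (the (fst y)))"
    define u3 where "u3 = (\<lambda>y\<in>states W2. vertex_perm \<Gamma> f (the (fst (snd y))) (the (fst y)))"
    define u4 where "u4 = (\<lambda>y\<in>states W3. fibre_update \<Gamma> f (the (fst (snd (snd y))))
      (the (fst (snd y))) (the (fst y)))"
    let ?u = "(u4, u3, u2, u1, Map.empty)"
    have c1: "u1 \<in> states (regular trivial_sgp) \<rightarrow>\<^sub>E carrier ?G1"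
      using arc_perm(1)[OF G f] by (auto simp: u1_def)
    have dom_au: "dom (arc_update \<Gamma> f g) \<subseteq> ?E" for g
      by (auto simp: arc_update_def split: if_splits)
    then have c2: "u2 \<in> states W1 \<rightarrow>\<^sub>E carrier ?A1" by (auto simp: u2_def)
    have c3: "u3 \<in> states W2 \<rightarrow>\<^sub>E carrier ?G2"
      using vertex_perm(1)[OF G f] by (auto simp: u3_def st2 st1)
    have fst_arc: "fst m \<in> ?V" if "m \<in> ?E" for m
      using that edge_vertices[OF G] by (auto simp: arcs_def)
    have fu: "dom (fibre_update \<Gamma> f g c k) \<subseteq> ?V" "ran (fibre_update \<Gamma> f g c k) \<subseteq> Pow ?V" for g c k
      using fst_arc by (auto simp: fibre_update_def ran_def split: if_splits)
    then have c4: "u4 \<in> states W3 \<rightarrow>\<^sub>E carrier ?A2" by (auto simp: u4_def)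
    have car: "?u \<in> carrier (sgp_of W4)"
      using c1 c2 c3 c4 by (simp add: W4_def W3_def W2_def W1_def)
    have "(act W4 y ?u, s \<odot>\<^bsub>MR \<Gamma>\<^esub> f) \<in> R" if ys: "(y, s) \<in> R" for y s
    proof -
      obtain d k c g where y: "y = (Some d, Some k, Some c, Some g, Some Map.empty)"
        and d: "dom d \<subseteq> ?V" "ran d \<subseteq> Pow ?V" and k: "k permutes ?V" and c: "dom c \<subseteq> ?E"
        and g: "g permutes ?E" and s: "s \<in> carrier (MR \<Gamma>)"
        and tr: "arcs_tracked \<Gamma> s g c" and fib: "fibres_tracked \<Gamma> s k d"
        using ys by (auto simp: R_def)
      have S1: "(Some g, Some Map.empty) \<in> states W1" using g by (simp add: st1)
      then have S2: "(Some c, Some g, Some Map.empty) \<in> states W2" using c by (simp add: st2)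
      then have S3: "(Some k, Some c, Some g, Some Map.empty) \<in> states W3" using k by (simp add: st3)
      have S0: "Some Map.empty \<in> states (regular trivial_sgp)"
        by (simp add: states_regular_monoid has_identity_reset_sgp)
      have "act W4 y ?u = (Some (d ++ fibre_update \<Gamma> f g c k), Some (vertex_perm \<Gamma> f g c \<circ> k),
          Some (c ++ arc_update \<Gamma> f g), Some (arc_perm \<Gamma> f \<circ> g), Some Map.empty)"
        using S0 S1 S2 S3
        by (simp add: y W4_def u4_def u3_def u2_def u1_def)
          (simp add: W3_def W2_def W1_def u3_def u2_def u1_def)
      moreover have "ran (d ++ fibre_update \<Gamma> f g c k) \<subseteq> Pow ?V"
        using d(2) fu(2)[of g c k] ran_map_add_subset[of d "fibre_update \<Gamma> f g c k"] by blast
      ultimately show ?thesis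
        using d(1) fu(1)[of g c k] c dom_au[of g] finite_sgp_closed[OF finite_sgp_MR[OF G] s f]
          permutes_compose[OF k vertex_perm(1)[OF G f g, where c = c]]
          permutes_compose[OF g arc_perm(1)[OF G f]]
          arcs_tracked_step[OF G f g tr] fibres_tracked_step[OF G f s g k tr fib]
        by (auto simp: R_def MR_simps)
    qed
    then show "\<exists>u\<in>carrier (sgp_of W4). \<forall>(y, s)\<in>R. (act W4 y u, s \<odot>\<^bsub>MR \<Gamma>\<^esub> f) \<in> R"
      using car by blast
  qed
  then show ?thesis
    unfolding W4_def W3_def W2_def W1_def
    using kr_decomposable_2I A by blast
qed

section \<open>One group level suffices for complete graphs\<close>

text \<open>What is left of a partial injection or a partial constant map after dividing by a permutation.\<close>

definition partial_id_const_sgp :: "'a set \<Rightarrow> ('a \<rightharpoonup> 'a) sgp" where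
  "partial_id_const_sgp X =
     \<lparr>carrier = {m. dom m \<subseteq> X \<and> ran m \<subseteq> X \<and>
        ((\<forall>x y. m x = Some y \<longrightarrow> y = x) \<or> (\<exists>c. ran m \<subseteq> {c}))},
      sgmult = \<lambda>m m'. m' \<circ>\<^sub>m m\<rparr>"

lemma partial_id_const_sgp_simps [simp]:
  "carrier (partial_id_const_sgp X) = {m. dom m \<subseteq> X \<and> ran m \<subseteq> X \<and>
     ((\<forall>x y. m x = Some y \<longrightarrow> y = x) \<or> (\<exists>c. ran m \<subseteq> {c}))}"
  "m \<odot>\<^bsub>partial_id_const_sgp X\<^esub> m' = m' \<circ>\<^sub>m m"
  by (simp_all add: partial_id_const_sgp_def)

lemma has_identity_partial_id_const_sgp: "has_identity (partial_id_const_sgp X)"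
  unfolding has_identity_def
proof (intro bexI ballI)
  let ?e = "\<lambda>x. if x \<in> X then Some x else None"
  show "?e \<in> carrier (partial_id_const_sgp X)"
    by (auto simp: ran_def split: if_splits)
  fix m assume m: "m \<in> carrier (partial_id_const_sgp X)"
  have "m x = None" if "x \<notin> X" for x using m that by (auto simp: dom_def)
  moreover have "y \<in> X" if "m x = Some y" for x y using m that by (auto simp: ran_def)
  ultimately show "?e \<odot>\<^bsub>partial_id_const_sgp X\<^esub> m = m \<and> m \<odot>\<^bsub>partial_id_const_sgp X\<^esub> ?e = m"
    by (auto simp: map_comp_def fun_eq_iff split: option.splits)
qed

lemma aperiodic_monoid_partial_id_const_sgp:
  assumes "finite X"
  shows "aperiodic_monoid (partial_id_const_sgp X)"
  unfolding aperiodic_monoid_def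
proof (intro conjI ballI has_identity_partial_id_const_sgp)
  let ?S = "partial_id_const_sgp X"
  show "finite_sgp ?S"
    unfolding finite_sgp_def
  proof (intro conjI ballI)
    show "finite (carrier ?S)"
      by (rule finite_subset[OF _ finite_partial_maps[OF assms assms]]) auto
    have "Map.empty \<in> carrier ?S" by simp
    then show "carrier ?S \<noteq> {}" by blast
    fix m m' assume m: "m \<in> carrier ?S" and m': "m' \<in> carrier ?S"
    have "dom (m' \<circ>\<^sub>m m) \<subseteq> X" "ran (m' \<circ>\<^sub>m m) \<subseteq> X"
      using m m' by (auto simp: map_comp_Some_iff ran_def dom_def)
    moreover have "(\<forall>x y. (m' \<circ>\<^sub>m m) x = Some y \<longrightarrow> y = x) \<or> (\<exists>c. ran (m' \<circ>\<^sub>m m) \<subseteq> {c})"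
    proof (cases "\<exists>c. ran m' \<subseteq> {c}")
      case True
      then show ?thesis by (auto simp: map_comp_Some_iff ran_def)
    next
      case False
      then have id': "\<forall>x y. m' x = Some y \<longrightarrow> y = x" using m' by simp
      then have "ran (m' \<circ>\<^sub>m m) \<subseteq> ran m" by (force simp: map_comp_Some_iff ran_def)
      moreover have "m x = Some y" if "(m' \<circ>\<^sub>m m) x = Some y" for x y
        using that id' by (auto simp: map_comp_Some_iff)
      moreover have "(\<forall>x y. m x = Some y \<longrightarrow> y = x) \<or> (\<exists>c. ran m \<subseteq> {c})" using m by simp
      ultimately show ?thesis by (meson order_trans)
    qed
    ultimately show "m \<odot>\<^bsub>?S\<^esub> m' \<in> carrier ?S" by simp
    show "m \<odot>\<^bsub>?S\<^esub> m' \<odot>\<^bsub>?S\<^esub> m'' = m \<odot>\<^bsub>?S\<^esub> (m' \<odot>\<^bsub>?S\<^esub> m'')" for m''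
      by (auto simp: map_comp_def fun_eq_iff split: option.splits)
  qed
  fix m assume "m \<in> carrier ?S"
  then consider "\<forall>x y. m x = Some y \<longrightarrow> y = x" | c where "ran m \<subseteq> {c}" by auto
  then have "m (the (m y)) = m y" if "m y \<noteq> None" "m (the (m y)) \<noteq> None" for y
  proof cases
    case 1
    then show ?thesis using that by auto
  next
    case 2
    then have "z = c" if "m x = Some z" for x z using that by (auto simp: ran_def)
    then show ?thesis using that by (metis not_None_eq option.sel)
  qed
  then show "m \<odot>\<^bsub>?S\<^esub> m \<odot>\<^bsub>?S\<^esub> m = m \<odot>\<^bsub>?S\<^esub> m"
    by (force simp: map_comp_def fun_eq_iff split: option.splits)
qed

definition complete_graph :: "'v graph \<Rightarrow> bool" where
  "complete_graph \<Gamma> \<longleftrightarrow> (\<forall>x\<in>fst \<Gamma>. \<forall>y\<in>fst \<Gamma>. x \<noteq> y \<longrightarrow> {x, y} \<in> snd \<Gamma>)"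

text \<open>Two different values are the ends of an edge, so fibres are singletons as soon as there are two
  values.\<close>

lemma MR_complete_graph_cases:
  assumes G: "finite_simple_graph \<Gamma>" and K: "complete_graph \<Gamma>" and f: "f \<in> carrier (MR \<Gamma>)"
  shows "inj_on f (dom f) \<or> (\<exists>c. ran f \<subseteq> {c})"
proof (cases "inj_on f (dom f)")
  case False
  then obtain x y a where xy: "x \<noteq> y" "f x = Some a" "f y = Some a"
    by (auto simp: inj_on_def dom_def)
  have "b = a" if z: "f z = Some b" for b z
  proof (rule ccontr)
    assume "b \<noteq> a"
    then have "{a, b} \<in> snd \<Gamma>"
      using K MR_vertex(2)[OF f] xy z unfolding complete_graph_def by metis
    from MR_edge_preimage(2)[OF G f this xy(2) z xy(3)] show False using xy(1) by simp
  qed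
  then have "ran f \<subseteq> {a}" by (auto simp: ran_def)
  then show ?thesis by blast
qed simp

text \<open>The product read so far is stored as a permutation \<open>k\<close> following a map \<open>a\<close> in
  \<open>partial_id_const_sgp\<close>. Reading \<open>f\<close>, a permutation \<open>h\<close> extending \<open>f\<close> if \<open>f\<close> is injective is
  composed to \<open>k\<close>; what is left of \<open>f\<close> acts on labels and has the right form in both cases.\<close>

theorem kr_decomposable_MR_complete_graph:
  fixes \<Gamma> :: "'a graph"
  assumes G: "finite_simple_graph \<Gamma>" and K: "complete_graph \<Gamma>"
  shows "kr_decomposable (MR \<Gamma>) 1"
proof -
  let ?V = "fst \<Gamma>"
  have V: "finite ?V" using G by (simp add: finite_simple_graph_def)
  let ?A = "partial_id_const_sgp ?V" and ?G = "perm_sgp ?V"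
  define W1 where "W1 = wreath (regular ?G) (regular trivial_sgp)"
  define W2 where "W2 = wreath (regular ?A) W1"
  have A: "aperiodic_monoid trivial_sgp" "aperiodic_monoid ?A" "finite_group ?G"
    using V by (simp_all add: aperiodic_monoid_reset_sgp finite_group_perm_sgp
        aperiodic_monoid_partial_id_const_sgp)
  have fin: "finite_tsgp W2"
    unfolding W2_def W1_def
    using A by (intro finite_tsgp_wreath finite_tsgp_regular)
      (auto simp: aperiodic_monoid_def finite_group_def)
  have st1: "states W1 = Some ` {k. k permutes ?V} \<times> {Some Map.empty}"
    by (auto simp: W1_def states_regular_monoid has_identity_reset_sgp has_identity_perm_sgp)
  have st2: "states W2 = Some ` carrier ?A \<times> states W1"
    by (simp add: W2_def states_regular_monoid has_identity_partial_id_const_sgp)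
  let ?id = "\<lambda>x. if x \<in> ?V then Some x else None"
  define R where "R = {((Some a, Some k, Some (Map.empty :: unit \<rightharpoonup> unit)), P) | a k P.
    a \<in> carrier ?A \<and> k permutes ?V \<and> P \<in> carrier (MR \<Gamma>) \<and> P = (\<lambda>x. map_option k (a x))}"
  have "MR \<Gamma> \<prec>\<prec> sgp_of W2"
  proof (rule divides_by_simulation[OF fin finite_sgp_MR[OF G] MR_identity[OF G],
        where R = R and q = "(Some ?id, Some id, Some Map.empty)"])
    show "?id \<odot>\<^bsub>MR \<Gamma>\<^esub> f = f" if "f \<in> carrier (MR \<Gamma>)" for f
    proof
      fix x
      show "(?id \<odot>\<^bsub>MR \<Gamma>\<^esub> f) x = f x"
        using MR_vertex(1)[OF that, of x] by (cases "f x") (auto simp: MR_simps map_comp_def)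
    qed
    show "R \<subseteq> states W2 \<times> carrier (MR \<Gamma>)"
      by (auto simp: R_def st2 st1)
    show "s = t" if "(y, s) \<in> R" "(y, t) \<in> R" for y s t
      using that unfolding R_def by auto
    have "?id \<in> carrier ?A" by (auto simp: ran_def split: if_splits)
    then show "((Some ?id, Some id, Some Map.empty), ?id) \<in> R"
      unfolding R_def using MR_identity[OF G] permutes_id[of ?V]
      by (intro CollectI exI[of _ ?id] exI[of _ id]) (simp add: option.map_id0)
    fix f assume f: "f \<in> carrier (MR \<Gamma>)"
    have "\<exists>h. h permutes ?V \<and> (inj_on f (dom f) \<longrightarrow> (\<forall>x\<in>dom f. h x = the (f x)))"
    proof (cases "inj_on f (dom f)")
      case True
      have "\<exists>h. h permutes ?V \<and> (\<forall>x\<in>dom f. h x = the (f x))"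
      proof (rule permutes_extends_inj_on[OF V])
        show "inj_on (\<lambda>x. the (f x)) (dom f)" using True by (auto simp: inj_on_def dom_def)
      qed (use MR_vertex[OF f] in auto)
      then show ?thesis by blast
    qed (use permutes_id in blast)
    then obtain h where h: "h permutes ?V" "inj_on f (dom f) \<Longrightarrow> \<forall>x\<in>dom f. h x = the (f x)"
      by blast
    define \<alpha> where "\<alpha> k l = map_option (inv_into UNIV (h \<circ> k)) (f (k l))"
      for k :: "'a \<Rightarrow> 'a" and l
    have \<alpha>: "\<alpha> k \<in> carrier ?A" and h\<alpha>: "map_option (h \<circ> k) (\<alpha> k l) = f (k l)"
      if k: "k permutes ?V" for k l
    proof -
      have hk: "(h \<circ> k) permutes ?V" using permutes_compose[OF k h(1)] .
      show "map_option (h \<circ> k) (\<alpha> k l) = f (k l)"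
        using permutes_inverses(1)[OF hk] by (cases "f (k l)") (simp_all add: \<alpha>_def)
      have "dom (\<alpha> k) \<subseteq> ?V"
        using MR_vertex(1)[OF f] by (force simp: \<alpha>_def permutes_in_image[OF k])
      moreover have "ran (\<alpha> k) \<subseteq> ?V"
        using MR_vertex(2)[OF f] by (auto simp: \<alpha>_def ran_def permutes_in_image[OF permutes_inv[OF hk]])
      moreover have "(\<forall>x y. \<alpha> k x = Some y \<longrightarrow> y = x) \<or> (\<exists>c. ran (\<alpha> k) \<subseteq> {c})"
        using MR_complete_graph_cases[OF G K f]
      proof
        assume "inj_on f (dom f)"
        then have "f (k x) = Some y \<Longrightarrow> (h \<circ> k) x = y" for x y using h(2) by force
        then show ?thesis using permutes_inverses(2)[OF hk] by (auto simp: \<alpha>_def)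
      next
        assume "\<exists>c. ran f \<subseteq> {c}"
        then obtain c where "ran f \<subseteq> {c}" by blast
        then have "ran (\<alpha> k) \<subseteq> {inv_into UNIV (h \<circ> k) c}" by (auto simp: \<alpha>_def ran_def)
        then show ?thesis by blast
      qed
      ultimately show "\<alpha> k \<in> carrier ?A" by simp
    qed
    define u1 where "u1 = (\<lambda>y\<in>states (regular trivial_sgp). h)"
    define u2 where "u2 = (\<lambda>y\<in>states W1. \<alpha> (the (fst y)))"
    let ?u = "(u2, u1, Map.empty)"
    have c1: "u1 \<in> states (regular trivial_sgp) \<rightarrow>\<^sub>E carrier ?G"
      using h by (auto simp: u1_def)
    have "\<alpha> (the (fst y)) \<in> carrier ?A" if "y \<in> states W1" for y
      using that by (intro \<alpha>) (auto simp: st1)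
    then have c2: "u2 \<in> states W1 \<rightarrow>\<^sub>E carrier ?A"
      unfolding u2_def restrict_PiE_iff by blast
    have car: "?u \<in> carrier (sgp_of W2)"
      using c1 c2 by (simp add: W2_def W1_def)
    have "(act W2 y ?u, s \<odot>\<^bsub>MR \<Gamma>\<^esub> f) \<in> R" if ys: "(y, s) \<in> R" for y s
    proof -
      obtain a k where y: "y = (Some a, Some k, Some Map.empty)"
        and a: "a \<in> carrier ?A" and k: "k permutes ?V" and s: "s \<in> carrier (MR \<Gamma>)"
        and eq: "s = (\<lambda>x. map_option k (a x))"
        using ys unfolding R_def by blast
      have S1: "(Some k, Some Map.empty) \<in> states W1" using k by (simp add: st1)
      have S0: "Some Map.empty \<in> states (regular trivial_sgp)"
        by (simp add: states_regular_monoid has_identity_reset_sgp)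
      have act: "act W2 y ?u = (Some (a \<odot>\<^bsub>?A\<^esub> \<alpha> k), Some (h \<circ> k), Some Map.empty)"
        using S0 S1 by (simp add: y W2_def u2_def) (simp add: W1_def u1_def)
      have "finite_sgp ?A" using A by (simp add: aperiodic_monoid_def)
      note car' = finite_sgp_closed[OF this a \<alpha>[OF k]]
      have "s \<odot>\<^bsub>MR \<Gamma>\<^esub> f = (\<lambda>x. map_option (h \<circ> k) ((a \<odot>\<^bsub>?A\<^esub> \<alpha> k) x))"
      proof
        fix x
        show "(s \<odot>\<^bsub>MR \<Gamma>\<^esub> f) x = map_option (h \<circ> k) ((a \<odot>\<^bsub>?A\<^esub> \<alpha> k) x)"
          using h\<alpha>[OF k] by (cases "a x") (simp_all add: eq MR_simps map_comp_def)
      qed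
      then show ?thesis
        unfolding R_def act
        using car' permutes_compose[OF k h(1)] finite_sgp_closed[OF finite_sgp_MR[OF G] s f]
        by blast
    qed
    then show "\<exists>u\<in>carrier (sgp_of W2). \<forall>(y, s)\<in>R. (act W2 y u, s \<odot>\<^bsub>MR \<Gamma>\<^esub> f) \<in> R"
      using car by blast
  qed
  then show ?thesis
    unfolding W2_def W1_def using kr_decomposable_1I A by blast
qed

section \<open>Powers in finite aperiodic semigroups\<close>

text \<open>The power of \<open>x\<close> with exponent \<open>k + 1\<close>; a semigroup need not have a zeroth power.\<close>

fun spow :: "'a sgp \<Rightarrow> 'a \<Rightarrow> nat \<Rightarrow> 'a" where
  "spow S x 0 = x"
| "spow S x (Suc k) = spow S x k \<odot>\<^bsub>S\<^esub> x"

lemma spow_closed: "finite_sgp S \<Longrightarrow> x \<in> carrier S \<Longrightarrow> spow S x k \<in> carrier S"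
  by (induction k) (simp_all add: finite_sgp_closed)

lemma spow_mult:
  assumes "finite_sgp S" "x \<in> carrier S"
  shows "spow S x j \<odot>\<^bsub>S\<^esub> spow S x k = spow S x (Suc (j + k))"
  by (induction k)
    (simp_all add: finite_sgp_assoc[OF assms(1), symmetric] spow_closed[OF assms] assms(2))

lemma spow_idempotent: "x \<odot>\<^bsub>S\<^esub> x = x \<Longrightarrow> spow S x k = x"
  by (induction k) simp_all

lemma spow_eventually_periodic:
  assumes S: "finite_sgp S" and x: "x \<in> carrier S"
  shows "\<exists>p>0. \<exists>i. \<forall>k\<ge>i. \<forall>q. spow S x (k + p * q) = spow S x k"
proof -
  have "finite (range (spow S x))"
    using finite_subset[of "range (spow S x)" "carrier S"] spow_closed[OF S x] S
    by (auto simp: finite_sgp_def)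
  then have "\<not> inj (spow S x)" using finite_imageD infinite_UNIV_nat by blast
  then obtain a b where ab: "spow S x a = spow S x b" "a \<noteq> b" by (auto simp: inj_def)
  define i p where "i = min a b" and "p = max a b - min a b"
  have p: "p > 0" and ip: "spow S x (i + p) = spow S x i"
    using ab by (auto simp: i_def p_def min_def max_def)
  have step: "spow S x (k + p) = spow S x k" if "i \<le> k" for k
    using that
  proof (induction k rule: dec_induct)
    case base
    then show ?case using ip by simp
  next
    case (step k)
    then show ?case by simp
  qed
  have "spow S x (k + p * q) = spow S x k" if "i \<le> k" for k q
  proof (induction q)
    case (Suc q)
    have "spow S x (k + p * Suc q) = spow S x ((k + p * q) + p)" by (simp add: algebra_simps)
    also have "\<dots> = spow S x k" using step[of "k + p * q"] Suc that by simp
    finally show ?case .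
  qed simp
  then show ?thesis using p by blast
qed

lemma idempotent_power:
  assumes S: "finite_sgp S" and x: "x \<in> carrier S"
  obtains k where "spow S x k \<odot>\<^bsub>S\<^esub> spow S x k = spow S x k"
proof -
  obtain p i where p: "p > 0" and per: "\<And>k q. i \<le> k \<Longrightarrow> spow S x (k + p * q) = spow S x k"
    using spow_eventually_periodic[OF S x] by blast
  define n where "n = p * Suc i"
  have "Suc i \<le> n" unfolding n_def using p by (cases p) simp_all
  then obtain k where n: "n = Suc k" and "i \<le> k" by (cases n) auto
  then have k: "i \<le> k" "Suc (k + k) = k + p * Suc i" unfolding n_def[symmetric] by simp_all
  have "spow S x k \<odot>\<^bsub>S\<^esub> spow S x k = spow S x k"
    unfolding spow_mult[OF S x] k(2) by (rule per[OF k(1)])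
  then show thesis by (rule that)
qed

text \<open>The eventually periodic part of the powers of \<open>x\<close> is a cyclic group, hence trivial. With period
  \<open>p\<close> from index \<open>i\<close> on, its identity is the power with exponent \<open>n = p (i + 1)\<close>.\<close>

lemma aperiodic_spow:
  assumes S: "finite_sgp S" and ap: "aperiodic S" and x: "x \<in> carrier S"
  shows "\<exists>m. spow S x (Suc m) = spow S x m"
proof -
  obtain p i where p: "p > 0" and per: "\<And>k q. i \<le> k \<Longrightarrow> spow S x (k + p * q) = spow S x k"
    using spow_eventually_periodic[OF S x] by blast
  let ?H = "spow S x ` {i..}"
  define n where "n = p * Suc i"
  have n: "Suc i \<le> n" unfolding n_def using p by (cases p) simp_all
  let ?G = "\<lparr>carrier = ?H, mult = sgmult S, one = spow S x (n - 1)\<rparr>"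
  note mul = spow_mult[OF S x]
  have "group ?G"
  proof (rule groupI)
    show "\<one>\<^bsub>?G\<^esub> \<in> carrier ?G" using n by auto
    fix a assume "a \<in> carrier ?G"
    then obtain k where k: "a = spow S x k" "i \<le> k" by auto
    have e1: "Suc (n - 1 + k) = k + p * Suc i" using n unfolding n_def[symmetric] by linarith
    have "spow S x (n - 1) \<odot>\<^bsub>S\<^esub> spow S x k = spow S x k"
      unfolding mul e1 by (rule per[OF k(2)])
    then show "\<one>\<^bsub>?G\<^esub> \<otimes>\<^bsub>?G\<^esub> a = a" using k by simp
    define l where "l = (k + 2) * (n - 1)"
    have "n - 1 \<le> l" by (simp add: l_def)
    then have l: "i \<le> l" using n by linarith
    obtain n' where n': "n = Suc n'" using n by (cases n) auto
    have e2: "Suc (l + k) = n - 1 + p * (Suc i * Suc k)"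
    proof -
      have "p * (Suc i * Suc k) = n * Suc k" unfolding n_def by (rule mult.assoc[symmetric])
      then show ?thesis by (simp add: l_def n' algebra_simps)
    qed
    have "i \<le> n - 1" using n by linarith
    then have "spow S x l \<odot>\<^bsub>S\<^esub> spow S x k = spow S x (n - 1)"
      unfolding mul e2 by (rule per)
    then show "\<exists>b\<in>carrier ?G. b \<otimes>\<^bsub>?G\<^esub> a = \<one>\<^bsub>?G\<^esub>"
      using l k by (auto intro!: bexI[of _ "spow S x l"])
    fix b assume "b \<in> carrier ?G"
    then obtain k' where k': "b = spow S x k'" "i \<le> k'" by auto
    show "a \<otimes>\<^bsub>?G\<^esub> b \<in> carrier ?G"
      using k k' by (auto simp: mul simp del: spow.simps)
    fix c assume "c \<in> carrier ?G"
    then obtain k'' where k'': "c = spow S x k''" by auto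
    show "a \<otimes>\<^bsub>?G\<^esub> b \<otimes>\<^bsub>?G\<^esub> c = a \<otimes>\<^bsub>?G\<^esub> (b \<otimes>\<^bsub>?G\<^esub> c)"
      using k k' k'' by (simp add: mul add.assoc del: spow.simps)
  qed
  then have "is_group (S\<lparr>carrier := ?H\<rparr>)" by (auto simp: is_group_def)
  moreover have "?H \<subseteq> carrier S" using spow_closed[OF S x] by blast
  ultimately have "card ?H = 1" using ap by (simp add: aperiodic_def)
  then obtain h where "?H = {h}" by (auto simp: card_1_singleton_iff)
  then have "spow S x (Suc i) = h" "spow S x i = h" by (auto simp del: spow.simps)
  then show ?thesis by metis
qed

lemma spow_stable_mono:
  assumes "spow S x (Suc m) = spow S x m" "m \<le> k"
  shows "spow S x k = spow S x m"
  using assms(2)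
proof (induction k rule: dec_induct)
  case (step k)
  then show ?case using assms(1) by simp
qed simp

lemma aperiodic_exponent:
  assumes S: "finite_sgp S" and ap: "aperiodic S"
  shows "\<exists>m. \<forall>x\<in>carrier S. \<forall>k\<ge>m. spow S x (Suc k) = spow S x k"
proof -
  define f where "f x = (SOME m. spow S x (Suc m) = spow S x m)" for x
  have f: "spow S x (Suc (f x)) = spow S x (f x)" if "x \<in> carrier S" for x
    unfolding f_def using aperiodic_spow[OF S ap that] by (rule someI_ex)
  have fin: "finite (f ` carrier S)" using S by (simp add: finite_sgp_def)
  have "spow S x (Suc k) = spow S x k" if "x \<in> carrier S" "Max (f ` carrier S) \<le> k" for x k
  proof -
    have "f x \<le> k" using Max_ge[OF fin, of "f x"] that by (meson imageI le_trans)
    then show ?thesis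
      using spow_stable_mono[OF f[OF that(1)], of k] spow_stable_mono[OF f[OF that(1)], of "Suc k"]
      by simp
  qed
  then show ?thesis by blast
qed

inductive_set sgp_span :: "'a sgp \<Rightarrow> 'a set \<Rightarrow> 'a set" for S X where
  gen: "x \<in> X \<Longrightarrow> x \<in> sgp_span S X"
| mult: "x \<in> sgp_span S X \<Longrightarrow> y \<in> sgp_span S X \<Longrightarrow> x \<odot>\<^bsub>S\<^esub> y \<in> sgp_span S X"

lemma hom_spow:
  assumes U: "subsgp U T" and h: "h \<in> sgp_hom (T\<lparr>carrier := U\<rparr>) S" and u: "u \<in> U"
  shows "spow T u k \<in> U" "h (spow T u k) = spow S (h u) k"
proof -
  have "spow T u k \<in> U \<and> h (spow T u k) = spow S (h u) k"
    using U h u by (induction k) (auto simp: subsgp_def sgp_hom_def)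
  then show "spow T u k \<in> U" "h (spow T u k) = spow S (h u) k" by auto
qed

lemma divides_aperiodic_spow:
  assumes T: "finite_sgp T" "aperiodic T" and ST: "S \<prec>\<prec> T" and x: "x \<in> carrier S"
  shows "\<exists>m. spow S x (Suc m) = spow S x m"
proof -
  obtain U h where U: "subsgp U T" and h: "h \<in> sgp_hom (T\<lparr>carrier := U\<rparr>) S" "h ` U = carrier S"
    using ST by (auto simp: divides_def)
  have "x \<in> h ` U" using x h(2) by simp
  then obtain u where u: "u \<in> U" "h u = x" by blast
  have "u \<in> carrier T" using U u(1) by (auto simp: subsgp_def)
  from aperiodic_spow[OF T this] obtain m where "spow T u (Suc m) = spow T u m" ..
  then have "h (spow T u (Suc m)) = h (spow T u m)" by (rule arg_cong)
  then have "spow S x (Suc m) = spow S x m" unfolding hom_spow(2)[OF U h(1) u(1)] u(2) .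
  then show ?thesis ..
qed

section \<open>An obstruction to a single group level\<close>

text \<open>An element of \<open>A1 \<wr> G \<wr> A0\<close> acts on the states of \<open>A0\<close> by \<open>\<tau>\<close>, multiplies the middle coordinate
  by \<open>\<gamma>\<close>, which depends on the state of \<open>A0\<close>, and the top coordinate by \<open>\<alpha>\<close>, which depends on both.\<close>

locale aga_wreath =
  fixes A1 :: "'a sgp" and G :: "'b sgp" and A0 :: "'c sgp"
  assumes A1: "finite_sgp A1" "aperiodic A1"
    and G: "finite_sgp G" "is_group G"
    and A0: "finite_sgp A0" "aperiodic A0"
begin

abbreviation "T \<equiv> sgp_of (wreath (regular A1) (wreath (regular G) (regular A0)))"
abbreviation "B0 \<equiv> states (regular A0)"
abbreviation "G0 \<equiv> states (regular G)"

abbreviation "\<tau> u b \<equiv> act (regular A0) b (snd (snd u))"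
abbreviation "\<gamma> u b \<equiv> fst (snd u) b"
abbreviation "\<alpha> u y \<equiv> fst u y"

lemma finite_tsgp_T:
  "finite_tsgp (wreath (regular A1) (wreath (regular G) (regular A0)))"
  using A1 G A0 by (intro finite_tsgp_wreath finite_tsgp_regular)

lemma finite_sgp_T: "finite_sgp T"
  using finite_tsgpD(2)[OF finite_tsgp_T] .

lemma coord_closed:
  assumes "u \<in> carrier T" "b \<in> B0"
  shows "\<tau> u b \<in> B0" "\<gamma> u b \<in> carrier G" "g \<in> G0 \<Longrightarrow> \<alpha> u (g, b) \<in> carrier A1"
proof -
  obtain f h t where u: "u = (f, h, t)" by (cases u) auto
  have f: "f \<in> G0 \<times> B0 \<rightarrow>\<^sub>E carrier A1" and h: "h \<in> B0 \<rightarrow>\<^sub>E carrier G" and t: "t \<in> carrier A0"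
    using assms(1) by (auto simp: u)
  show "\<tau> u b \<in> B0"
    using finite_tsgpD(3)[OF finite_tsgp_regular[OF A0(1)] assms(2)] t by (simp add: u)
  show "\<gamma> u b \<in> carrier G" using h assms(2) by (auto simp: u)
  show "g \<in> G0 \<Longrightarrow> \<alpha> u (g, b) \<in> carrier A1" using f assms(2) by (auto simp: u)
qed

lemma bottom_closed: "u \<in> carrier T \<Longrightarrow> snd (snd u) \<in> carrier A0"
  by auto

lemma coord_mult:
  assumes "u \<in> carrier T" "v \<in> carrier T" "b \<in> B0"
  shows "\<tau> (u \<odot>\<^bsub>T\<^esub> v) b = \<tau> v (\<tau> u b)"
    and "\<gamma> (u \<odot>\<^bsub>T\<^esub> v) b = \<gamma> u b \<odot>\<^bsub>G\<^esub> \<gamma> v (\<tau> u b)"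
    and "g \<in> G0 \<Longrightarrow> \<alpha> (u \<odot>\<^bsub>T\<^esub> v) (g, b) =
      \<alpha> u (g, b) \<odot>\<^bsub>A1\<^esub> \<alpha> v (act (regular G) g (\<gamma> u b), \<tau> u b)"
proof -
  obtain f h t where u: "u = (f, h, t)" by (cases u) auto
  obtain f' h' t' where v: "v = (f', h', t')" by (cases v) auto
  have t: "t \<in> carrier A0" "t' \<in> carrier A0" using assms by (auto simp: u v)
  show "\<tau> (u \<odot>\<^bsub>T\<^esub> v) b = \<tau> v (\<tau> u b)"
    using finite_tsgpD(4)[OF finite_tsgp_regular[OF A0(1)] assms(3), of t t'] t
    by (simp add: u v)
  show "\<gamma> (u \<odot>\<^bsub>T\<^esub> v) b = \<gamma> u b \<odot>\<^bsub>G\<^esub> \<gamma> v (\<tau> u b)"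
    using assms(3) by (simp add: u v)
  show "g \<in> G0 \<Longrightarrow> \<alpha> (u \<odot>\<^bsub>T\<^esub> v) (g, b) =
      \<alpha> u (g, b) \<odot>\<^bsub>A1\<^esub> \<alpha> v (act (regular G) g (\<gamma> u b), \<tau> u b)"
    using assms(3) by (simp add: u v)
qed

lemma bottom_mult: "snd (snd (u \<odot>\<^bsub>T\<^esub> v)) = snd (snd u) \<odot>\<^bsub>A0\<^esub> snd (snd v)"
  by (cases u; cases v) simp

lemma regular_faithful:
  assumes "finite_sgp S" "s \<in> carrier S" "t \<in> carrier S"
    and "\<And>b. b \<in> states (regular S) \<Longrightarrow> act (regular S) b s = act (regular S) b t"
  shows "s = t"
proof (cases "has_identity S")
  case True
  then obtain e where "e \<in> carrier S" "\<forall>x\<in>carrier S. e \<odot>\<^bsub>S\<^esub> x = x"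
    by (auto simp: has_identity_def)
  then show ?thesis using assms(4)[of "Some e"] assms(2,3) True
    by (simp add: states_regular_monoid)
next
  case False
  then have "None \<in> states (regular S)" by (simp add: regular_def)
  then show ?thesis using assms(4)[of None] by simp
qed

lemma coord_ext:
  assumes u: "u \<in> carrier T" and v: "v \<in> carrier T"
    and "\<And>b. b \<in> B0 \<Longrightarrow> \<tau> u b = \<tau> v b"
    and "\<And>b. b \<in> B0 \<Longrightarrow> \<gamma> u b = \<gamma> v b"
    and "\<And>g b. g \<in> G0 \<Longrightarrow> b \<in> B0 \<Longrightarrow> \<alpha> u (g, b) = \<alpha> v (g, b)"
  shows "u = v"
proof -
  have "snd (snd u) = snd (snd v)"
    using assms by (intro regular_faithful[OF A0(1)]) auto
  moreover have "fst (snd u) = fst (snd v)"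
    using u v assms(4) by (intro PiE_ext[of _ B0 "\<lambda>_. carrier G"]) auto
  moreover have "fst u = fst v"
  proof (rule PiE_ext)
    show "fst u \<in> G0 \<times> B0 \<rightarrow>\<^sub>E carrier A1" "fst v \<in> G0 \<times> B0 \<rightarrow>\<^sub>E carrier A1"
      using u v by (simp_all add: mem_Times_iff)
    show "fst u x = fst v x" if "x \<in> G0 \<times> B0" for x
      using that assms(5) by (cases x) simp
  qed
  ultimately show ?thesis by (simp add: prod_eq_iff)
qed

lemma bottom_spow: "snd (snd (spow T u k)) = spow A0 (snd (snd u)) k"
  by (induction k) (simp_all add: bottom_mult)

lemma \<tau>_spow_Suc:
  "u \<in> carrier T \<Longrightarrow> b \<in> B0 \<Longrightarrow> \<tau> (spow T u (Suc k)) b = \<tau> u (\<tau> (spow T u k) b)"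
  using coord_mult(1)[of "spow T u k" u b] spow_closed[OF finite_sgp_T] by simp

text \<open>As \<open>A0\<close> is aperiodic, some power of \<open>\<tau> u\<close> does not change when it is followed by \<open>\<tau> u\<close>. Every
  point of \<open>B\<close> is a value of this power, so \<open>\<tau> u\<close> fixes it.\<close>

lemma \<tau>_surjective_imp_identity:
  assumes u: "u \<in> carrier T" and B: "B \<subseteq> B0" "\<tau> u ` B = B" and b: "b \<in> B"
  shows "\<tau> u b = b"
proof -
  obtain m where m: "\<And>x k. x \<in> carrier A0 \<Longrightarrow> m \<le> k \<Longrightarrow> spow A0 x (Suc k) = spow A0 x k"
    using aperiodic_exponent[OF A0] by blast
  have "\<tau> (spow T u k) ` B = B" for k
  proof (induction k)
    case (Suc k)
    have "\<tau> (spow T u (Suc k)) ` B = \<tau> u ` \<tau> (spow T u k) ` B"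
      unfolding image_image using B(1) \<tau>_spow_Suc[OF u] by (intro image_cong) auto
    then show ?case using Suc B(2) by simp
  qed (simp add: B)
  then obtain c where c: "c \<in> B" "b = \<tau> (spow T u m) c" using b by blast
  have "c \<in> B0" using c B by auto
  have "snd (snd u) \<in> carrier A0" using bottom_closed[OF u] .
  then have "snd (snd (spow T u (Suc m))) = snd (snd (spow T u m))"
    unfolding bottom_spow using m by simp
  then show ?thesis using \<tau>_spow_Suc[OF u \<open>c \<in> B0\<close>, of m] c by simp
qed

text \<open>The two conditions on \<open>\<epsilon>\<close>, for a power \<open>q\<close> of \<open>r\<close> with inverse \<open>q'\<close>, imply that \<open>\<epsilon> q'\<close> lies in the
  \<open>L\<close>-class of \<open>e\<close>; for transformations they say that \<open>\<epsilon>\<close> is a retraction onto the image of \<open>e\<close>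
  moved by \<open>q\<close>.\<close>

theorem span_of_idempotents_aperiodic:
  fixes S :: "'s sgp"
  assumes S: "finite_sgp S" and div: "S \<prec>\<prec> T"
    and i: "i \<in> carrier S" "\<And>x. x \<in> carrier S \<Longrightarrow> i \<odot>\<^bsub>S\<^esub> x = x"
      "\<And>x. x \<in> carrier S \<Longrightarrow> x \<odot>\<^bsub>S\<^esub> i = x"
    and r: "r \<in> carrier S" "spow S r N = i"
    and e: "e \<in> carrier S" "e \<odot>\<^bsub>S\<^esub> e = e"
    and X: "\<And>\<epsilon>. \<epsilon> \<in> X \<Longrightarrow> \<epsilon> \<in> carrier S \<and> \<epsilon> \<odot>\<^bsub>S\<^esub> \<epsilon> = \<epsilon> \<and>
      (\<exists>j j'. spow S r j \<odot>\<^bsub>S\<^esub> spow S r j' = i \<and>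
        e \<odot>\<^bsub>S\<^esub> spow S r j \<odot>\<^bsub>S\<^esub> \<epsilon> = e \<odot>\<^bsub>S\<^esub> spow S r j \<and>
        \<epsilon> \<odot>\<^bsub>S\<^esub> spow S r j' \<odot>\<^bsub>S\<^esub> e = \<epsilon> \<odot>\<^bsub>S\<^esub> spow S r j')"
    and \<pi>: "\<pi> \<in> sgp_span S X"
  shows "\<exists>m. spow S \<pi> (Suc m) = spow S \<pi> m"
proof -
  obtain U h where U: "subsgp U T" and h: "h \<in> sgp_hom (T\<lparr>carrier := U\<rparr>) S" "h ` U = carrier S"
    using div by (auto simp: divides_def)
  have UT: "u \<in> carrier T" if "u \<in> U" for u using U that by (auto simp: subsgp_def)
  have Um: "u \<odot>\<^bsub>T\<^esub> v \<in> U" if "u \<in> U" "v \<in> U" for u v using U that by (simp add: subsgp_def)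
  have hS: "h u \<in> carrier S" if "u \<in> U" for u using h(1) that by (auto simp: sgp_hom_def)
  have hm: "h (u \<odot>\<^bsub>T\<^esub> v) = h u \<odot>\<^bsub>S\<^esub> h v" if "u \<in> U" "v \<in> U" for u v
    using h(1) that by (simp add: sgp_hom_def)
  have lift: "\<exists>u\<in>U. h u = s" if "s \<in> carrier S" for s
    using that unfolding h(2)[symmetric] by blast
  note Scl = finite_sgp_closed[OF S] and Sas = finite_sgp_assoc[OF S]
  note hp = hom_spow[OF U h(1)]
  obtain m where m: "\<And>x k. x \<in> carrier A0 \<Longrightarrow> m \<le> k \<Longrightarrow> spow A0 x (Suc k) = spow A0 x k"
    using aperiodic_exponent[OF A0] by blast
  have finB0: "finite B0" using finite_tsgpD(1)[OF finite_tsgp_regular[OF A0(1)]] .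
  note c\<tau> = coord_closed(1)[OF UT] and mt = coord_mult(1)[OF UT UT]

  obtain r' where r': "r' \<in> U" "h r' = r" using lift[OF r(1)] by blast
  (* The exponent (N + 1) (m + 1) makes the power of r' a lift of the identity, and it is large
     enough for the bottom component to be stable, so that r' fixes its image pointwise. *)
  define K where "K = Suc N * Suc m - 1"
  have Ki: "spow S r (Suc N * Suc k - 1) = i" for k
  proof (induction k)
    case (Suc k)
    have "spow S r (Suc N * Suc (Suc k) - 1) = spow S r (Suc (N + (Suc N * Suc k - 1)))"
      by (simp add: algebra_simps)
    also have "\<dots> = spow S r N \<odot>\<^bsub>S\<^esub> spow S r (Suc N * Suc k - 1)"
      by (rule spow_mult[OF S r(1), symmetric])
    finally show ?case using Suc r(2) i by simp
  qed (simp add: r)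
  define i' where "i' = spow T r' K"
  have i': "i' \<in> U" "h i' = i"
    using hp[OF r'(1), of K] r'(2) Ki[of m] by (simp_all add: i'_def K_def)
  have "m \<le> K" by (simp add: K_def)
  have r_fix: "\<tau> r' (\<tau> i' b) = \<tau> i' b" if b: "b \<in> B0" for b
  proof -
    have "snd (snd r') \<in> carrier A0" using bottom_closed[OF UT[OF r'(1)]] .
    then have "snd (snd (spow T r' (Suc K))) = snd (snd (spow T r' K))"
      unfolding bottom_spow using m \<open>m \<le> K\<close> by blast
    then show ?thesis using \<tau>_spow_Suc[OF UT[OF r'(1)] b, of K] by (simp add: i'_def)
  qed

  (* The L-class of e; minimality over all lifts of L is what turns maps into B into
     bijections of B. *)
  define L where "L = {s \<in> carrier S. s \<odot>\<^bsub>S\<^esub> e = s \<and> (\<exists>v\<in>carrier S. v \<odot>\<^bsub>S\<^esub> s = e)}"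
  have "e \<in> L" using e by (auto simp: L_def)
  then obtain u0 where "u0 \<in> U \<and> h u0 \<in> L" using lift e(1) by metis
  then obtain w0 where w0: "w0 \<in> U" "h w0 \<in> L"
    and min: "\<And>u. u \<in> U \<Longrightarrow> h u \<in> L \<Longrightarrow> card (\<tau> w0 ` B0) \<le> card (\<tau> u ` B0)"
    using ex_has_least_nat[of "\<lambda>u. u \<in> U \<and> h u \<in> L" u0 "\<lambda>u. card (\<tau> u ` B0)"] by auto
  define w where "w = w0 \<odot>\<^bsub>T\<^esub> i'"
  have w: "w \<in> U" "h w \<in> L"
    using w0 i' Um hm i(3)[OF hS[OF w0(1)]] by (simp_all add: w_def)
  define B where "B = \<tau> w ` B0"
  have B_eq: "B = \<tau> i' ` \<tau> w0 ` B0"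
    unfolding B_def w_def image_image using mt[OF w0(1) i'(1)] by (rule image_cong[OF refl])
  have B_sub: "B \<subseteq> B0" using c\<tau>[OF w(1)] by (auto simp: B_def)
  then have finB: "finite B" using finB0 finite_subset by blast
  have B_min: "card B \<le> card (\<tau> u ` B0)" if "u \<in> U" "h u \<in> L" for u
  proof -
    have "card B \<le> card (\<tau> w0 ` B0)" unfolding B_eq using finB0 by (intro card_image_le) simp
    then show ?thesis using min[OF that] by simp
  qed
  have r_id: "\<tau> r' b = b" if "b \<in> B" for b
    using that c\<tau>[OF w0(1)] r_fix unfolding B_eq by auto
  have rk_id: "\<tau> (spow T r' k) b = b" if b: "b \<in> B" for b k
  proof (induction k)
    case (Suc k)
    have "b \<in> B0" using b B_sub by blast
    then show ?case using \<tau>_spow_Suc[OF UT[OF r'(1)], of b k] Suc r_id[OF b] by simp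
  qed (simp add: r_id[OF b])

  obtain s v where s: "s = h w" "s \<in> carrier S" "s \<odot>\<^bsub>S\<^esub> e = s"
    and v: "v \<in> carrier S" "v \<odot>\<^bsub>S\<^esub> s = e"
    using w(2) by (auto simp: L_def)

  have lift_idem: "\<exists>z\<in>U. h z = \<epsilon> \<and> z \<odot>\<^bsub>T\<^esub> z = z \<and> \<tau> z ` B0 \<subseteq> B \<and> (\<forall>b\<in>B. \<tau> z b = b)"
    if \<epsilon>X: "\<epsilon> \<in> X" for \<epsilon>
  proof -
    obtain j j' where \<epsilon>: "\<epsilon> \<in> carrier S" "\<epsilon> \<odot>\<^bsub>S\<^esub> \<epsilon> = \<epsilon>"
      and j: "spow S r j \<odot>\<^bsub>S\<^esub> spow S r j' = i"
      and je: "e \<odot>\<^bsub>S\<^esub> spow S r j \<odot>\<^bsub>S\<^esub> \<epsilon> = e \<odot>\<^bsub>S\<^esub> spow S r j"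
        "\<epsilon> \<odot>\<^bsub>S\<^esub> spow S r j' \<odot>\<^bsub>S\<^esub> e = \<epsilon> \<odot>\<^bsub>S\<^esub> spow S r j'"
      using X[OF \<epsilon>X] by blast
    define q q' where "q = spow S r j" and "q' = spow S r j'"
    have q: "q \<in> carrier S" "q' \<in> carrier S"
      using spow_closed[OF S r(1)] by (simp_all add: q_def q'_def)
    have qq: "q \<odot>\<^bsub>S\<^esub> q' = i" "q' \<odot>\<^bsub>S\<^esub> q = i"
      using j spow_mult[OF S r(1), of j j'] spow_mult[OF S r(1), of j' j]
      by (simp_all add: q_def q'_def add.commute)
    define y where "y = \<epsilon> \<odot>\<^bsub>S\<^esub> q'"
    have y: "y \<in> carrier S" "y \<odot>\<^bsub>S\<^esub> e = y" "y \<odot>\<^bsub>S\<^esub> q = \<epsilon>"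
      using \<epsilon>(1) q qq je(2) i(3) by (simp_all add: y_def Scl Sas q'_def[symmetric])
    have eqy: "e \<odot>\<^bsub>S\<^esub> q \<odot>\<^bsub>S\<^esub> y = e"
    proof -
      have "e \<odot>\<^bsub>S\<^esub> q \<odot>\<^bsub>S\<^esub> y = e \<odot>\<^bsub>S\<^esub> q \<odot>\<^bsub>S\<^esub> \<epsilon> \<odot>\<^bsub>S\<^esub> q'"
        using e \<epsilon> q by (simp add: y_def Scl Sas)
      also have "\<dots> = e" using je(1) e q qq i(3) by (simp add: q_def[symmetric] Sas)
      finally show ?thesis .
    qed
    obtain x where x: "x \<in> U" "h x = y \<odot>\<^bsub>S\<^esub> v" using lift Scl y(1) v(1) by metis
    define q1 where "q1 = spow T r' j"
    have q1: "q1 \<in> U" "h q1 = q" using hp[OF r'(1), of j] r'(2) by (simp_all add: q1_def q_def)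
    (* As w is the next to last factor and q1 fixes B, the image of z0 lies in B. *)
    define z0 where "z0 = x \<odot>\<^bsub>T\<^esub> w \<odot>\<^bsub>T\<^esub> q1"
    have z0: "z0 \<in> U" using x(1) w(1) q1(1) Um by (simp add: z0_def)
    have hz0: "h z0 = \<epsilon>"
    proof -
      have "h z0 = y \<odot>\<^bsub>S\<^esub> v \<odot>\<^bsub>S\<^esub> s \<odot>\<^bsub>S\<^esub> q"
        using x w q1 Um hm s(1) by (simp add: z0_def)
      also have "\<dots> = y \<odot>\<^bsub>S\<^esub> e \<odot>\<^bsub>S\<^esub> q" using y(1) v s(2) q by (simp add: Sas Scl)
      finally show ?thesis using y by simp
    qed
    have \<tau>z0: "\<tau> z0 b = \<tau> w (\<tau> x b)" if b: "b \<in> B0" for b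
    proof -
      have "\<tau> z0 b = \<tau> q1 (\<tau> w (\<tau> x b))"
        unfolding z0_def using mt[OF Um[OF x(1) w(1)] q1(1) b] mt[OF x(1) w(1) b] by simp
      moreover have "\<tau> w (\<tau> x b) \<in> B" using c\<tau>[OF x(1) b] by (simp add: B_def)
      ultimately show ?thesis using rk_id by (simp add: q1_def)
    qed
    have z0_B: "\<tau> z0 b \<in> B" if "b \<in> B0" for b
      using \<tau>z0[OF that] c\<tau>[OF x(1) that] by (simp add: B_def)
    (* A lift of an element of L whose image is that of B under z0; so z0 cannot shrink B. *)
    define w' where "w' = w \<odot>\<^bsub>T\<^esub> q1 \<odot>\<^bsub>T\<^esub> x \<odot>\<^bsub>T\<^esub> w"
    have w': "w' \<in> U" using x(1) w(1) q1(1) Um by (simp add: w'_def)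
    have "h w' = s \<odot>\<^bsub>S\<^esub> q \<odot>\<^bsub>S\<^esub> (y \<odot>\<^bsub>S\<^esub> v) \<odot>\<^bsub>S\<^esub> s"
      using x w q1 Um hm s(1) by (simp add: w'_def)
    also have "\<dots> = s \<odot>\<^bsub>S\<^esub> q \<odot>\<^bsub>S\<^esub> y" using y v s q by (simp add: Sas Scl)
    finally have hw': "h w' = s \<odot>\<^bsub>S\<^esub> q \<odot>\<^bsub>S\<^esub> y" .
    have "h w' \<in> L"
    proof -
      have "v \<odot>\<^bsub>S\<^esub> (s \<odot>\<^bsub>S\<^esub> q \<odot>\<^bsub>S\<^esub> y) = v \<odot>\<^bsub>S\<^esub> s \<odot>\<^bsub>S\<^esub> q \<odot>\<^bsub>S\<^esub> y"
        using v(1) s(2) q y(1) by (simp add: Sas Scl)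
      also have "\<dots> = e" using v(2) eqy by simp
      finally have "v \<odot>\<^bsub>S\<^esub> h w' = e" using hw' by simp
      moreover have "h w' \<odot>\<^bsub>S\<^esub> e = h w'" using hw' y s(2) q e(1) by (simp add: Sas Scl)
      ultimately show ?thesis using v(1) hS[OF w'] by (auto simp: L_def)
    qed
    then have "card B \<le> card (\<tau> w' ` B0)" by (rule B_min[OF w'])
    also have "\<tau> w' ` B0 = \<tau> z0 ` B"
    proof -
      have "\<tau> w' b = \<tau> z0 (\<tau> w b)" if b: "b \<in> B0" for b
      proof -
        have wb: "\<tau> w b \<in> B" "\<tau> w b \<in> B0" using b B_sub by (auto simp: B_def)
        have "\<tau> w' b = \<tau> w (\<tau> x (\<tau> q1 (\<tau> w b)))"
          unfolding w'_def
          using mt[OF Um[OF Um[OF w(1) q1(1)] x(1)] w(1) b] mt[OF Um[OF w(1) q1(1)] x(1) b]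
            mt[OF w(1) q1(1) b] by simp
        then show ?thesis using rk_id[OF wb(1), of j] \<tau>z0[OF wb(2)] by (simp add: q1_def)
      qed
      then show ?thesis unfolding B_def image_image by (rule image_cong[OF refl])
    qed
    finally have "card B \<le> card (\<tau> z0 ` B)" .
    moreover have "\<tau> z0 ` B \<subseteq> B" using z0_B B_sub by blast
    ultimately have "\<tau> z0 ` B = B" by (intro card_seteq[OF finB])
    then have z0_id: "\<tau> z0 b = b" if "b \<in> B" for b
      using \<tau>_surjective_imp_identity[OF UT[OF z0] B_sub _ that] by blast
    obtain k where k: "spow T z0 k \<odot>\<^bsub>T\<^esub> spow T z0 k = spow T z0 k"
      by (rule idempotent_power[OF finite_sgp_T UT[OF z0]])
    have "h (spow T z0 k) = \<epsilon>" using hp[OF z0] hz0 spow_idempotent[OF \<epsilon>(2)] by simp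
    moreover have in_B: "\<tau> (spow T z0 l) b = \<tau> z0 b" if b: "b \<in> B0" for b l
    proof (induction l)
      case (Suc l)
      then show ?case using \<tau>_spow_Suc[OF UT[OF z0] b, of l] z0_id[OF z0_B[OF b]] by simp
    qed simp
    ultimately show ?thesis
      using k hp(1)[OF z0, of k] z0_B z0_id B_sub by (intro bexI[of _ "spow T z0 k"]) auto
  qed

  obtain one where one: "group \<lparr>carrier = carrier G, mult = sgmult G, one = one\<rparr>"
    using G(2) by (auto simp: is_group_def)
  then interpret G: group "\<lparr>carrier = carrier G, mult = sgmult G, one = one\<rparr>" .
  (* Lifts acting trivially on B and on the middle coordinate over B. *)
  define F where "F = {z \<in> U. \<tau> z ` B0 \<subseteq> B \<and> (\<forall>b\<in>B. \<tau> z b = b \<and> \<gamma> z b = one)}"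
  have F_mult: "z \<odot>\<^bsub>T\<^esub> z' \<in> F" if "z \<in> F" "z' \<in> F" for z z'
  proof -
    have z: "z \<in> U" "z' \<in> U" using that by (auto simp: F_def)
    have "\<tau> (z \<odot>\<^bsub>T\<^esub> z') b \<in> B" if "b \<in> B0" for b
      using mt[OF z that] c\<tau>[OF z(1) that] \<open>z' \<in> F\<close> by (auto simp: F_def)
    moreover have "\<tau> (z \<odot>\<^bsub>T\<^esub> z') b = b \<and> \<gamma> (z \<odot>\<^bsub>T\<^esub> z') b = one" if b: "b \<in> B" for b
    proof -
      have b0: "b \<in> B0" using b B_sub by blast
      have "\<tau> z b = b" "\<tau> z' b = b" "\<gamma> z b = one" "\<gamma> z' b = one"
        using that \<open>z \<in> F\<close> \<open>z' \<in> F\<close> by (auto simp: F_def)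
      then show ?thesis
        using mt[OF z b0] coord_mult(2)[OF UT[OF z(1)] UT[OF z(2)] b0] G.l_one[of one] G.one_closed
        by simp
    qed
    ultimately show ?thesis using Um z by (auto simp: F_def)
  qed
  have "\<exists>p\<in>F. h p = \<pi>" using \<pi>
  proof induction
    case (gen \<epsilon>)
    obtain z where z: "z \<in> U" "h z = \<epsilon>" "z \<odot>\<^bsub>T\<^esub> z = z" "\<tau> z ` B0 \<subseteq> B" "\<forall>b\<in>B. \<tau> z b = b"
      using lift_idem[OF gen] by blast
    have "\<gamma> z b = one" if b: "b \<in> B" for b
    proof -
      have b0: "b \<in> B0" using b B_sub by blast
      have "\<gamma> z b \<odot>\<^bsub>G\<^esub> \<gamma> z b = \<gamma> z b"
        using coord_mult(2)[OF UT[OF z(1)] UT[OF z(1)] b0] z(3,5) b by simp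
      then show ?thesis using G.l_cancel_one[of "\<gamma> z b" "\<gamma> z b"] coord_closed(2)[OF UT[OF z(1)] b0]
        by simp
    qed
    then have "z \<in> F" using z by (simp add: F_def)
    then show ?case using z(2) by blast
  next
    case (mult x y)
    then obtain p p' where "p \<in> F" "p' \<in> F" "h p = x" "h p' = y" by blast
    moreover from this have "h (p \<odot>\<^bsub>T\<^esub> p') = h p \<odot>\<^bsub>S\<^esub> h p'" by (intro hm) (simp_all add: F_def)
    ultimately show ?case using F_mult by blast
  qed
  then obtain p where p: "p \<in> F" "h p = \<pi>" by blast
  then have pU: "p \<in> U" and pB: "\<And>b. b \<in> B0 \<Longrightarrow> \<tau> p b \<in> B"
    and p_id: "\<And>b. b \<in> B \<Longrightarrow> \<tau> p b = b" "\<And>b. b \<in> B \<Longrightarrow> \<gamma> p b = one"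
    by (auto simp: F_def)
  note pT = UT[OF pU]
  have pk: "spow T p k \<in> carrier T" for k using spow_closed[OF finite_sgp_T pT] .
  have \<tau>p: "\<tau> (spow T p k) b = \<tau> p b" if b: "b \<in> B0" for b k
  proof (induction k)
    case (Suc k)
    then show ?case using \<tau>_spow_Suc[OF pT b, of k] p_id(1)[OF pB[OF b]] by simp
  qed simp
  have \<gamma>p: "\<gamma> (spow T p k) b = \<gamma> p b" if b: "b \<in> B0" for b k
  proof (induction k)
    case (Suc k)
    then show ?case
      using coord_mult(2)[OF pk pT b, of k] \<tau>p[OF b, of k] p_id(2)[OF pB[OF b]]
        G.r_one[of "\<gamma> p b"] coord_closed(2)[OF pT b] by simp
  qed simp
  have \<alpha>p: "\<alpha> (spow T p (Suc k)) (g, b) =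
      \<alpha> p (g, b) \<odot>\<^bsub>A1\<^esub> spow A1 (\<alpha> p (act (regular G) g (\<gamma> p b), \<tau> p b)) k"
    if g: "g \<in> G0" and b: "b \<in> B0" for g b k
  proof (induction k)
    case 0
    show ?case using coord_mult(3)[OF pT pT b g] by simp
  next
    case (Suc k)
    let ?c = "\<alpha> p (act (regular G) g (\<gamma> p b), \<tau> p b)"
    have "act (regular G) g (\<gamma> p b) \<in> G0"
      using finite_tsgpD(3)[OF finite_tsgp_regular[OF G(1)] g] coord_closed(2)[OF pT b] by simp
    then have c: "?c \<in> carrier A1" using coord_closed(3)[OF pT coord_closed(1)[OF pT b]] by blast
    have "\<alpha> (spow T p (Suc (Suc k))) (g, b) = \<alpha> (spow T p (Suc k)) (g, b) \<odot>\<^bsub>A1\<^esub> ?c"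
      using coord_mult(3)[OF pk pT b g, of "Suc k"] \<tau>p[OF b, of "Suc k"] \<gamma>p[OF b, of "Suc k"]
      by simp
    also have "\<dots> = \<alpha> p (g, b) \<odot>\<^bsub>A1\<^esub> spow A1 ?c (Suc k)"
      using Suc finite_sgp_assoc[OF A1(1) coord_closed(3)[OF pT b g] spow_closed[OF A1(1) c] c]
      by simp
    finally show ?case .
  qed
  obtain m1 where m1: "\<And>x k. x \<in> carrier A1 \<Longrightarrow> m1 \<le> k \<Longrightarrow> spow A1 x (Suc k) = spow A1 x k"
    using aperiodic_exponent[OF A1] by blast
  have "spow T p (Suc (Suc m1)) = spow T p (Suc m1)"
  proof (rule coord_ext[OF pk pk])
    fix b assume b: "b \<in> B0"
    show "\<tau> (spow T p (Suc (Suc m1))) b = \<tau> (spow T p (Suc m1)) b"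
      by (simp only: \<tau>p[OF b])
    show "\<gamma> (spow T p (Suc (Suc m1))) b = \<gamma> (spow T p (Suc m1)) b"
      by (simp only: \<gamma>p[OF b])
    fix g assume g: "g \<in> G0"
    let ?c = "\<alpha> p (act (regular G) g (\<gamma> p b), \<tau> p b)"
    have "act (regular G) g (\<gamma> p b) \<in> G0"
      using finite_tsgpD(3)[OF finite_tsgp_regular[OF G(1)] g] coord_closed(2)[OF pT b] by simp
    then have "?c \<in> carrier A1" using coord_closed(3)[OF pT coord_closed(1)[OF pT b]] by blast
    then have "spow A1 ?c (Suc m1) = spow A1 ?c m1" by (rule m1) simp
    then show "\<alpha> (spow T p (Suc (Suc m1))) (g, b) = \<alpha> (spow T p (Suc m1)) (g, b)"
      by (simp only: \<alpha>p[OF g b])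
  qed
  then have "spow S \<pi> (Suc (Suc m1)) = spow S \<pi> (Suc m1)"
    using hp(2)[OF pU] p(2) by metis
  then show ?thesis by blast
qed

end

section \<open>Elements of the monoid of a cycle\<close>

lemma cycle_graph_edge: "i < n \<Longrightarrow> Suc i mod n \<noteq> i \<Longrightarrow> {i, Suc i mod n} \<in> snd (cycle_graph n)"
  unfolding cycle_graph_def snd_conv by blast

lemma complete_graph_cycle_graph:
  assumes "n \<le> 3"
  shows "complete_graph (cycle_graph n)"
proof -
  have "n = 0 \<or> n = 1 \<or> n = 2 \<or> n = 3" using assms by linarith
  moreover have "{x, y} \<in> snd (cycle_graph 3)" if "x < 3" "y < 3" "x \<noteq> y" for x y :: nat
  proof -
    have "{0, 1} \<in> snd (cycle_graph 3)" "{1, 2} \<in> snd (cycle_graph 3)" "{2, 0} \<in> snd (cycle_graph 3)"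
      using cycle_graph_edge[of 0 3] cycle_graph_edge[of 1 3] cycle_graph_edge[of 2 3]
      by (simp_all add: numeral_2_eq_2)
    moreover have "x = 0 \<or> x = 1 \<or> x = 2" "y = 0 \<or> y = 1 \<or> y = 2" using that by auto
    ultimately show ?thesis using that(3) by (auto simp: insert_commute)
  qed
  moreover have "complete_graph (cycle_graph 1)" "complete_graph (cycle_graph 2)"
    unfolding cycle_graph_1 cycle_graph_2 complete_graph_def by (auto simp: insert_commute)
  ultimately show ?thesis
    by (auto simp: complete_graph_def cycle_graph_def)
qed

lemma mod_Suc_less: "x < n \<Longrightarrow> Suc x mod n = (if Suc x = n then 0 else Suc x)"
  by auto

lemma cycle_graph_simplices:
  "v < n \<Longrightarrow> {v} \<in> simplices (cycle_graph n)"
  "i < n \<Longrightarrow> Suc i mod n \<noteq> i \<Longrightarrow> {i, Suc i mod n} \<in> simplices (cycle_graph n)"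
  by (auto simp: simplices_def cycle_graph_def)

lemma MR_cycle_graphI:
  assumes "dom f \<subseteq> {..<n}" "ran f \<subseteq> {..<n}"
    and "\<And>v. v < n \<Longrightarrow> full_preimage f {v} \<in> simplices (cycle_graph n) \<or> full_preimage f {v} = {}"
    and "\<And>i. i < n \<Longrightarrow> full_preimage f {i, Suc i mod n} \<in> simplices (cycle_graph n) \<or>
      full_preimage f {i, Suc i mod n} = {}"
  shows "f \<in> carrier (MR (cycle_graph n))"
proof -
  have "full_preimage f \<sigma> \<in> simplices (cycle_graph n) \<or> full_preimage f \<sigma> = {}"
    if "\<sigma> \<in> simplices (cycle_graph n)" for \<sigma>
  proof -
    from that consider v where "\<sigma> = {v}" "v < n" | i where "\<sigma> = {i, Suc i mod n}" "i < n"
      unfolding simplices_def cycle_graph_def by auto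
    then show ?thesis using assms(3,4) by cases simp_all
  qed
  then show ?thesis using assms(1,2) by (simp add: MR_def cycle_graph_def)
qed

text \<open>Fibres lie in an edge, and the range contains no two neighbours, so the preimage of an edge is a
  fibre.\<close>

lemma step_back_map_in_MR:
  assumes n: "n \<ge> 2"
    and step: "\<And>x v. f x = Some v \<Longrightarrow> v < n \<and> (x = v \<or> x = Suc v mod n)"
    and indep: "\<And>v. v \<in> ran f \<Longrightarrow> Suc v mod n \<notin> ran f"
  shows "f \<in> carrier (MR (cycle_graph n))"
proof (rule MR_cycle_graphI)
  show "dom f \<subseteq> {..<n}" using step n by fastforce
  show "ran f \<subseteq> {..<n}" using step by (fastforce simp: ran_def)
  have single: "full_preimage f {v} \<in> simplices (cycle_graph n) \<or> full_preimage f {v} = {}"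
    if v: "v < n" for v
  proof -
    have "full_preimage f {v} \<subseteq> {v, Suc v mod n}"
      using step by (auto simp: full_preimage_def)
    then have "full_preimage f {v} \<in> {{}, {v}, {Suc v mod n}, {v, Suc v mod n}}" by blast
    moreover have "Suc v mod n \<noteq> v" "Suc v mod n < n" using n v by (auto simp: mod_Suc_less)
    ultimately show ?thesis using v cycle_graph_simplices by auto
  qed
  fix i assume i: "i < n"
  show "full_preimage f {i} \<in> simplices (cycle_graph n) \<or> full_preimage f {i} = {}"
    using single[OF i] .
  have i': "Suc i mod n < n" using n by simp
  show "full_preimage f {i, Suc i mod n} \<in> simplices (cycle_graph n) \<or>
      full_preimage f {i, Suc i mod n} = {}"
  proof (cases "i \<in> ran f")
    case True
    then have "full_preimage f {i, Suc i mod n} = full_preimage f {i}"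
      using indep[OF True] by (auto simp: full_preimage_def ran_def)
    then show ?thesis using single[OF i] by simp
  next
    case False
    then have "full_preimage f {i, Suc i mod n} = full_preimage f {Suc i mod n}"
      by (auto simp: full_preimage_def ran_def)
    then show ?thesis using single[OF i'] by simp
  qed
qed

definition rotation :: "nat \<Rightarrow> nat \<Rightarrow> nat \<rightharpoonup> nat" where
  "rotation n a = (\<lambda>x. if x < n then Some ((x + a) mod n) else None)"

lemma rotation_in_MR:
  assumes n: "n \<ge> 2"
  shows "rotation n 1 \<in> carrier (MR (cycle_graph n))"
proof (rule MR_cycle_graphI)
  show "dom (rotation n 1) \<subseteq> {..<n}" by (auto simp: rotation_def split: if_splits)
  show "ran (rotation n 1) \<subseteq> {..<n}" by (auto simp: rotation_def ran_def split: if_splits)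
  define p where "p i = (if i = 0 then n - 1 else i - 1)" for i
  have p: "full_preimage (rotation n 1) {i} = {p i}" "p i < n" "Suc (p i) mod n = i"
    if "i < n" for i
    using that n
    by (auto simp: full_preimage_def rotation_def p_def mod_Suc_less split: if_splits)
  fix i assume i: "i < n"
  show "full_preimage (rotation n 1) {i} \<in> simplices (cycle_graph n) \<or>
      full_preimage (rotation n 1) {i} = {}"
    using p[OF i] by (simp add: cycle_graph_simplices)
  have i': "Suc i mod n < n" using i by simp
  have "full_preimage (rotation n 1) {i, Suc i mod n} =
      full_preimage (rotation n 1) {i} \<union> full_preimage (rotation n 1) {Suc i mod n}"
    by (auto simp: full_preimage_def)
  also have "\<dots> = {p i, i}"
    using p(1)[OF i] p(1)[OF i'] i n by (auto simp: p_def mod_Suc_less)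
  finally have "full_preimage (rotation n 1) {i, Suc i mod n} = {p i, Suc (p i) mod n}"
    using p(3)[OF i] by simp
  moreover have "Suc (p i) mod n \<noteq> p i" using p(2,3)[OF i] n i by (auto simp: p_def split: if_splits)
  ultimately show "full_preimage (rotation n 1) {i, Suc i mod n} \<in> simplices (cycle_graph n) \<or>
      full_preimage (rotation n 1) {i, Suc i mod n} = {}"
    using cycle_graph_simplices(2) p(2)[OF i] by simp
qed

lemma spow_rotation: "spow (MR \<Gamma>) (rotation n 1) j = rotation n (Suc j)"
proof (induction j)
  case (Suc j)
  then show ?case
    by (auto simp: MR_simps rotation_def map_comp_def fun_eq_iff mod_simps)
qed simp

section \<open>A rotation generated by idempotents\<close>

text \<open>The identity on an independent set with \<open>k\<close> points in the cycle on \<open>n\<close> vertices if \<open>n\<close> is \<open>2 k\<close> or \<open>2 k + 1\<close>.\<close>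

definition even_points :: "nat \<Rightarrow> nat \<rightharpoonup> nat" where
  "even_points k = (\<lambda>x. if even x \<and> x < 2 * k then Some x else None)"

text \<open>For even \<open>n\<close> this is \<open>even_points\<close>. For odd \<open>n = 2 k + 1\<close> the gap between \<open>2 k - 2\<close> and \<open>0\<close>
  is wider than the others, and the point \<open>0\<close> is moved back into it, to \<open>2 k\<close>. The image is
  \<open>{2, 4, \<dots>, 2 k}\<close> modulo \<open>n\<close>, the domain of \<open>even_points\<close> rotated by two steps.\<close>

definition open_gap :: "nat \<Rightarrow> nat \<Rightarrow> nat \<rightharpoonup> nat" where
  "open_gap n k = (\<lambda>x. if x = 0 then Some (2 * k mod n)
     else if even x \<and> x \<le> 2 * k \<and> x < n then Some x else None)"

text \<open>Moves the points \<open>2, 4, \<dots>, 2 k\<close> modulo \<open>n\<close> back by one step; for even \<open>n\<close> the point \<open>2 k\<close> is \<open>0\<close>,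
  which goes to \<open>n - 1\<close>.\<close>

definition to_odd :: "nat \<Rightarrow> nat \<rightharpoonup> nat" where
  "to_odd n = (\<lambda>x. if x \<ge> n then None else if odd x then Some x
     else if x > 0 then Some (x - 1) else if even n then Some (n - 1) else None)"

definition to_even :: "nat \<Rightarrow> nat \<rightharpoonup> nat" where
  "to_even k = (\<lambda>x. if x < 2 * k then Some (2 * (x div 2)) else None)"

context
  fixes n k :: nat
  assumes k: "k \<ge> 2" and n: "n = 2 * k \<or> n = Suc (2 * k)"
begin

lemma even_points_in_MR: "even_points k \<in> carrier (MR (cycle_graph n))"
  by (rule step_back_map_in_MR)
    (use k n in \<open>auto simp: even_points_def ran_def mod_Suc_less split: if_splits\<close>)

lemma to_even_in_MR: "to_even k \<in> carrier (MR (cycle_graph n))"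
proof (rule step_back_map_in_MR)
  show "n \<ge> 2" using k n by auto
  fix x v assume "to_even k x = Some v"
  then have x: "x < 2 * k" "v = 2 * (x div 2)" by (auto simp: to_even_def split: if_splits)
  then have "x = v \<or> x = Suc v" by presburger
  moreover have "x < n" using x n by auto
  ultimately show "v < n \<and> (x = v \<or> x = Suc v mod n)" by auto
next
  fix v assume "v \<in> ran (to_even k)"
  then have "even v" "v < 2 * k" by (auto simp: to_even_def ran_def split: if_splits)
  then have "odd (Suc v mod n)" using n by (auto simp: mod_Suc_less)
  moreover have "even w" if "w \<in> ran (to_even k)" for w
    using that by (auto simp: to_even_def ran_def split: if_splits)
  ultimately show "Suc v mod n \<notin> ran (to_even k)" by blast
qed

lemma to_odd_in_MR: "to_odd n \<in> carrier (MR (cycle_graph n))"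
proof (rule step_back_map_in_MR)
  show "n \<ge> 2" using k n by auto
  show "v < n \<and> (x = v \<or> x = Suc v mod n)" if "to_odd n x = Some v" for x v
    using that k n by (auto simp: to_odd_def mod_Suc_less split: if_splits)
  have ran: "odd v \<and> v < n" if "v \<in> ran (to_odd n)" for v
    using that k n by (auto simp: to_odd_def ran_def split: if_splits)
  fix v assume "v \<in> ran (to_odd n)"
  then have "even (Suc v mod n)" using ran by (auto simp: mod_Suc_less)
  then show "Suc v mod n \<notin> ran (to_odd n)" using ran by blast
qed

lemma open_gap_eq:
  "open_gap n k = (\<lambda>x. if x = 0 then Some (if n = 2 * k then 0 else 2 * k)
     else if even x \<and> x \<le> 2 * k \<and> x < n then Some x else None)"
  using n by (auto simp: open_gap_def)

lemma open_gap_in_MR: "open_gap n k \<in> carrier (MR (cycle_graph n))"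
proof (rule step_back_map_in_MR)
  show "n \<ge> 2" using k n by auto
  show "v < n \<and> (x = v \<or> x = Suc v mod n)" if "open_gap n k x = Some v" for x v
    using that k n by (auto simp: open_gap_eq split: if_splits)
  fix v assume "v \<in> ran (open_gap n k)"
  then have v: "even v \<and> v < n \<and> (v = 0 \<longrightarrow> n = 2 * k)"
    using k n by (auto simp: open_gap_eq ran_def split: if_splits)
  have ran: "even w \<and> (w = 0 \<longrightarrow> n = 2 * k)" if "w \<in> ran (open_gap n k)" for w
    using that k n by (auto simp: open_gap_eq ran_def split: if_splits)
  show "Suc v mod n \<notin> ran (open_gap n k)"
  proof
    assume "Suc v mod n \<in> ran (open_gap n k)"
    from ran[OF this] v have "even (Suc v) \<or> Suc v = n \<and> n = 2 * k"
      by (auto simp: mod_Suc_less split: if_splits)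
    then show False using v by (metis dvd_triv_left even_Suc)
  qed
qed

lemma idempotents:
  "even_points k \<circ>\<^sub>m even_points k = even_points k"
  "to_even k \<circ>\<^sub>m to_even k = to_even k"
  "to_odd n \<circ>\<^sub>m to_odd n = to_odd n"
  "open_gap n k \<circ>\<^sub>m open_gap n k = open_gap n k"
  using k n
  by (auto simp: fun_eq_iff map_comp_def even_points_def to_even_def to_odd_def open_gap_eq)

lemma image_is_rotated_even_points:
  assumes "a = 0 \<and> f = to_even k \<or> a = 1 \<and> f = to_odd n \<or> a = 2 \<and> f = open_gap n k"
  shows "f \<circ>\<^sub>m (rotation n a \<circ>\<^sub>m even_points k) = rotation n a \<circ>\<^sub>m even_points k"
    and "even_points k \<circ>\<^sub>m (rotation n (n - a) \<circ>\<^sub>m f) = rotation n (n - a) \<circ>\<^sub>m f"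
proof -
  have "f ((x + a) mod n) = Some ((x + a) mod n)" if x: "even x" "x < 2 * k" for x
    using assms
  proof (elim disjE conjE)
    show ?thesis if "a = 0" "f = to_even k" using that x n by (auto simp: to_even_def)
    show ?thesis if "a = 1" "f = to_odd n"
    proof -
      have "Suc x \<noteq> 2 * k" using x(1) by (metis dvd_triv_left even_Suc)
      then have "Suc x < n" using x n by auto
      then show ?thesis using that x by (simp add: to_odd_def)
    qed
    show ?thesis if "a = 2" "f = open_gap n k"
    proof (cases "x + 2 = n")
      case True
      then have "n = 2 * k" using x n by presburger
      then show ?thesis unfolding that(2) open_gap_eq using True that(1) by simp
    next
      case False
      then have "x + 2 < n" "x + 2 \<le> 2 * k" using x n by presburger+
      then show ?thesis unfolding that(2) open_gap_eq using that(1) x by simp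
    qed
  qed
  moreover have "x < n" if "x < 2 * k" for x using that n by auto
  ultimately show "f \<circ>\<^sub>m (rotation n a \<circ>\<^sub>m even_points k) = rotation n a \<circ>\<^sub>m even_points k"
    by (auto simp: fun_eq_iff map_comp_def rotation_def even_points_def)
  have "even ((v + (n - a)) mod n) \<and> (v + (n - a)) mod n < 2 * k" if v: "f x = Some v" "v < n" for x v
    using assms
  proof (elim disjE conjE)
    show ?thesis if "a = 0" "f = to_even k"
      using that v by (auto simp: to_even_def split: if_splits)
    show ?thesis if "a = 1" "f = to_odd n"
    proof -
      have "odd v" using v that n by (auto simp: to_odd_def split: if_splits)
      then have w: "v + (n - 1) = (v - 1) + n" "v - 1 < n" "even (v - 1)" "v - 1 < 2 * k"
        using v(2) n k by presburger+
      have "(v + (n - a)) mod n = v - 1"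
        unfolding that(1) w(1) mod_add_self2 by (rule mod_less[OF w(2)])
      then show ?thesis using w by presburger
    qed
    show ?thesis if "a = 2" "f = open_gap n k"
    proof -
      have e: "even v" "v = 0 \<longrightarrow> n = 2 * k"
        using v n k unfolding that(2) open_gap_eq by (auto split: if_splits)
      show ?thesis
      proof (cases "v = 0")
        case True
        then show ?thesis using e that(1) n k by auto
      next
        case False
        then have w: "v + (n - 2) = (v - 2) + n" "v - 2 < n" "even (v - 2)" "v - 2 < 2 * k"
          using n k e(1) v(2) by presburger+
        have "(v + (n - a)) mod n = v - 2"
          unfolding that(1) w(1) mod_add_self2 by (rule mod_less[OF w(2)])
        then show ?thesis using w by presburger
      qed
    qed
  qed
  then show "even_points k \<circ>\<^sub>m (rotation n (n - a) \<circ>\<^sub>m f) = rotation n (n - a) \<circ>\<^sub>m f"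
    by (auto simp: fun_eq_iff map_comp_def rotation_def even_points_def split: option.splits)
qed

text \<open>All points except \<open>0\<close> move back by one step twice. The point \<open>0\<close> first passes to \<open>2 k\<close> modulo \<open>n\<close>
  and then moves back like the others, to \<open>2 k - 2\<close>.\<close>

lemma product_rotates_even_points:
  assumes "even x" "x < 2 * k"
  shows "(to_even k \<circ>\<^sub>m to_odd n \<circ>\<^sub>m open_gap n k) x =
    Some (if x = 0 then 2 * k - 2 else x - 2)"
proof (cases "x = 0")
  case True
  have "(2 * k - 1) div 2 = k - 1" using k by (cases k) auto
  then show ?thesis using True n k
    by (auto simp: map_comp_def open_gap_eq to_odd_def to_even_def diff_mult_distrib2)
next
  case False
  then obtain m where m: "x = 2 * Suc m" using assms(1) by (metis evenE mult_0_right not0_implies_Suc)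
  then have "x < n" "m < k" using assms(2) n by auto
  then show ?thesis using False m assms n k
    by (auto simp: map_comp_def open_gap_eq to_odd_def to_even_def)
qed

lemma not_stable:
  assumes \<pi>: "\<pi> = to_even k \<circ>\<^sub>m to_odd n \<circ>\<^sub>m open_gap n k"
  shows "spow (MR (cycle_graph n)) \<pi> (Suc m) \<noteq> spow (MR (cycle_graph n)) \<pi> m"
proof -
  have step: "\<exists>z. \<pi> y = Some z \<and> even z \<and> z < 2 * k \<and> z \<noteq> y" if "even y" "y < 2 * k" for y
    using product_rotates_even_points[OF that] that k unfolding \<pi> by auto
  have "\<exists>y. spow (MR (cycle_graph n)) \<pi> m 0 = Some y \<and> even y \<and> y < 2 * k"
  proof (induction m)
    case 0
    then show ?case using step[of 0] k by auto
  next
    case (Suc m)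
    then show ?case using step by (fastforce simp: MR_simps)
  qed
  then obtain y where y: "spow (MR (cycle_graph n)) \<pi> m 0 = Some y" "even y" "y < 2 * k" by blast
  from step[OF y(2,3)] obtain z where "\<pi> y = Some z" "z \<noteq> y" by blast
  then have "spow (MR (cycle_graph n)) \<pi> (Suc m) 0 \<noteq> spow (MR (cycle_graph n)) \<pi> m 0"
    using y(1) by (simp add: MR_simps)
  then show ?thesis by metis
qed

text \<open>The cyclic permutation of the \<open>k\<close> even points is a product of idempotents that are retractions
  onto rotated copies of this set, so a single group level would force its powers to become
  stationary.\<close>

theorem not_kr_decomposable_MR_cycle_graph:
  shows "\<not> kr_decomposable (MR (cycle_graph n)) 0"
    and "\<not> kr_decomposable (MR (cycle_graph n)) 1"
proof -
  let ?S = "MR (cycle_graph n)"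
  define \<pi> where "\<pi> = to_even k \<circ>\<^sub>m to_odd n \<circ>\<^sub>m open_gap n k"
  note S = finite_sgp_MR[OF finite_simple_graph_cycle_graph, of n]
  let ?X = "{open_gap n k, to_odd n, to_even k}"
  have X: "?X \<subseteq> carrier ?S" using open_gap_in_MR to_odd_in_MR to_even_in_MR by simp
  have pi_span: "\<pi> \<in> sgp_span ?S ?X"
  proof -
    note mult = sgp_span.mult[of _ ?S ?X, unfolded MR_simps]
    have "to_even k \<circ>\<^sub>m (to_odd n \<circ>\<^sub>m open_gap n k) \<in> sgp_span ?S ?X"
      by (rule mult[OF mult[OF sgp_span.gen sgp_span.gen] sgp_span.gen]) simp_all
    moreover have "to_even k \<circ>\<^sub>m (to_odd n \<circ>\<^sub>m open_gap n k) = \<pi>"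
      by (auto simp: \<pi>_def map_comp_def fun_eq_iff split: option.splits)
    ultimately show ?thesis by simp
  qed
  have "x \<in> carrier ?S" if "x \<in> sgp_span ?S ?X" for x
    using that by induction (use X finite_sgp_closed[OF S] in auto)
  then have pi: "\<pi> \<in> carrier ?S" using pi_span .
  note unstable = not_stable[OF \<pi>_def]
  show "\<not> kr_decomposable ?S 0"
  proof
    assume "kr_decomposable ?S 0"
    then obtain A0 :: "nat sgp" and W where A0: "finite_sgp A0" "aperiodic A0"
      and W: "iter_wreath [A0] W" "?S \<prec>\<prec> sgp_of W"
      by (auto simp: kr_decomposable_def)
    have "sgp_iso A0 (sgp_of W)"
      using tsgp_iso_imp_sgp_iso[OF iter_wreath_single_iso[OF W(1)]] by simp
    then have "?S \<prec>\<prec> A0" using divides_iso[OF _ A0(1)] W(2) by blast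
    then show False using divides_aperiodic_spow[OF A0 _ pi] unstable by blast
  qed
  show "\<not> kr_decomposable ?S 1"
  proof
    assume "kr_decomposable ?S 1"
    then obtain A G :: "nat \<Rightarrow> nat sgp" and W where
      A: "\<forall>i\<le>1. finite_sgp (A i) \<and> aperiodic (A i)"
      and G: "\<forall>i\<in>{1..1}. finite_sgp (G i) \<and> is_group (G i)"
      and W: "iter_wreath [A 1, G 1, A 0] W" "?S \<prec>\<prec> sgp_of W"
      by (auto simp: kr_decomposable_def)
    interpret aga_wreath "A 1" "G 1" "A 0" using A G by unfold_locales auto
    obtain V1 where V1: "iter_wreath [G 1, A 0] V1" "tsgp_iso (wreath (regular (A 1)) V1) W"
      using W(1) by (rule iter_wreath_Cons_iso)
    obtain V0 where V0: "iter_wreath [A 0] V0" "tsgp_iso (wreath (regular (G 1)) V0) V1"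
      using V1(1) by (rule iter_wreath_Cons_iso)
    note f0 = finite_tsgp_regular[OF A0(1)]
      and f1 = finite_tsgp_regular[OF G(1)] and f2 = finite_tsgp_regular[OF A1(1)]
    have i1: "tsgp_iso (wreath (regular (G 1)) (regular (A 0))) V1"
      by (rule tsgp_iso_trans[OF tsgp_iso_wreath[OF tsgp_iso_refl iter_wreath_single_iso[OF V0(1)] f1 f0] V0(2)])
    have i2: "tsgp_iso (wreath (regular (A 1)) (wreath (regular (G 1)) (regular (A 0)))) W"
      by (rule tsgp_iso_trans[OF tsgp_iso_wreath[OF tsgp_iso_refl i1 f2 finite_tsgp_wreath[OF f1 f0]] V1(2)])
    have div: "?S \<prec>\<prec> T"
      using divides_iso[OF tsgp_iso_imp_sgp_iso[OF i2] finite_sgp_T] W(2) by blast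
    have n2: "n \<ge> 2" "n > 2" using n k by auto
    have id: "x \<odot>\<^bsub>?S\<^esub> rotation n n = x" "rotation n n \<odot>\<^bsub>?S\<^esub> x = x" if x: "x \<in> carrier ?S" for x
      using MR_vertex[OF x]
      by (auto simp: MR_simps rotation_def map_comp_def fun_eq_iff cycle_graph_def split: option.splits)
        (metis not_None_eq)
    have rotation_mult: "rotation n (n - a) \<circ>\<^sub>m rotation n a = rotation n n" if "a \<le> n" for a
    proof
      fix x
      have "((x + a) mod n + (n - a)) mod n = (x + a + (n - a)) mod n" by (rule mod_add_left_eq)
      also have "x + a + (n - a) = x + n" using that by simp
      finally show "(rotation n (n - a) \<circ>\<^sub>m rotation n a) x = rotation n n x"
        by (simp add: rotation_def map_comp_def)
    qed
    have spow: "spow ?S (rotation n 1) (a - 1) = rotation n a" if "a > 0" for a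
      using that spow_rotation[of "cycle_graph n" n "a - 1"] by simp
    have rot0: "rotation n 0 = rotation n n" by (auto simp: rotation_def fun_eq_iff)
    have "\<exists>m. spow ?S \<pi> (Suc m) = spow ?S \<pi> m"
    proof (rule span_of_idempotents_aperiodic[OF S div _ id(2) id(1) rotation_in_MR[OF n2(1)] spow
          even_points_in_MR _ _ pi_span])
      show "rotation n n \<in> carrier ?S"
        using spow_closed[OF S rotation_in_MR[OF n2(1)], of "n - 1"] spow[of n] n2 by simp
      show "n > 0" using n2 by simp
      show "even_points k \<odot>\<^bsub>?S\<^esub> even_points k = even_points k"
        by (simp add: MR_simps idempotents)
      fix \<epsilon> assume \<epsilon>: "\<epsilon> \<in> ?X"
      then obtain a :: nat where a:
        "a = 0 \<and> \<epsilon> = to_even k \<or> a = 1 \<and> \<epsilon> = to_odd n \<or> a = 2 \<and> \<epsilon> = open_gap n k" by blast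
      note im = image_is_rotated_even_points[OF a]
      (* Every rotation is needed as a positive power of the rotation by one step. *)
      define b where "b = (if a = 0 then n else a)"
      have b: "b > 0" "rotation n b = rotation n a" and na: "n - a > 0" "a \<le> n"
        using a n2 rot0 by (auto simp: b_def)
      obtain j j' where j: "spow ?S (rotation n 1) j = rotation n a"
        "spow ?S (rotation n 1) j' = rotation n (n - a)"
        using spow[OF b(1)] b(2) spow[OF na(1)] by metis
      have "\<epsilon> \<odot>\<^bsub>?S\<^esub> \<epsilon> = \<epsilon>" using \<epsilon> by (auto simp: MR_simps idempotents)
      then show "\<epsilon> \<in> carrier ?S \<and> \<epsilon> \<odot>\<^bsub>?S\<^esub> \<epsilon> = \<epsilon> \<and>
        (\<exists>j j'. spow ?S (rotation n 1) j \<odot>\<^bsub>?S\<^esub> spow ?S (rotation n 1) j' = rotation n n \<and>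
          even_points k \<odot>\<^bsub>?S\<^esub> spow ?S (rotation n 1) j \<odot>\<^bsub>?S\<^esub> \<epsilon> =
            even_points k \<odot>\<^bsub>?S\<^esub> spow ?S (rotation n 1) j \<and>
          \<epsilon> \<odot>\<^bsub>?S\<^esub> spow ?S (rotation n 1) j' \<odot>\<^bsub>?S\<^esub> even_points k =
            \<epsilon> \<odot>\<^bsub>?S\<^esub> spow ?S (rotation n 1) j')"
        using X \<epsilon> im rotation_mult[OF na(2)]
        by (intro conjI exI[of _ j] exI[of _ j']) (auto simp: MR_simps j simp del: One_nat_def)
    qed
    then show False using unstable by blast
  qed
qed

end

theorem theorem11p6:
  fixes n :: nat
  assumes "n \<ge> 1"
  shows "kr_complexity (MR (cycle_graph n)) = 2 \<longleftrightarrow> n \<ge> 4"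
proof
  assume c: "kr_complexity (MR (cycle_graph n)) = 2"
  show "n \<ge> 4"
  proof (rule ccontr)
    assume "\<not> n \<ge> 4"
    then have "complete_graph (cycle_graph n)" by (intro complete_graph_cycle_graph) simp
    then have "kr_decomposable (MR (cycle_graph n)) 1"
      by (rule kr_decomposable_MR_complete_graph[OF finite_simple_graph_cycle_graph])
    then have "kr_complexity (MR (cycle_graph n)) \<le> 1"
      unfolding kr_complexity_def by (rule Least_le)
    then show False using c by simp
  qed
next
  assume n: "n \<ge> 4"
  have k: "n div 2 \<ge> 2" "n = 2 * (n div 2) \<or> n = Suc (2 * (n div 2))" using n by presburger+
  note not = not_kr_decomposable_MR_cycle_graph[OF k]
  show "kr_complexity (MR (cycle_graph n)) = 2"
    unfolding kr_complexity_def
  proof (rule Least_equality)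
    show "kr_decomposable (MR (cycle_graph n)) 2"
      by (rule kr_decomposable_MR[OF finite_simple_graph_cycle_graph])
    fix m assume "kr_decomposable (MR (cycle_graph n)) m"
    then have "m \<noteq> 0" "m \<noteq> 1" using not by metis+
    then show "2 \<le> m" by simp
  qed
qed

end
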